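(* Let $n,\alpha$ be positive integers, $\varepsilon\in(0,1)$ and $\beta\ge 1$. Suppose a dataset $S$ over the universe $[n]$ is distributed across $\alpha$ players and has $C=\beta\cdot O\left(\min\left(F_0(S),\frac{1}{\varepsilon^2}\right)\right)$ pairwise collisions. Then there exists a protocol that, with probability at least $\frac{2}{3}$, outputs a $(1+\varepsilon)$-approximation to $F_0(S)$ and uses \[O(\alpha\log n)+O\left(\min\left(F_0(S),\frac{1}{\varepsilon^2}\right)\right)\cdot\sqrt{\beta}\log n\] bits of communication.
   Context: Distributed distinct element estimation (coordinator model): there are $\alpha$ servers (players), one of which acts as coordinator; server $a$ holds a vector $v^{(a)}\in\{0,1\}^n$ (equivalently a subset of $[n]$), and $S$ denotes the union (multiset) of all items held by the servers. All communication goes between the coordinator and the other servers; the communication cost is the total number of bits exchanged in the worst case. $F_0(S)$ is the number of distinct elements of $S$, i.e., the number of $j\in[n]$ with $v^{(a)}_j=1$ for some $a$. The number of pairwise collisions is the number of triples $(a,b,i)$ with $1\le a<b\le\alpha$, $i\in[n]$ and $v^{(a)}_i=v^{(b)}_i=1$. A $(1+\varepsilon)$-approximation to a quantity $F$ is a value $\hat F$ with $(1-\varepsilon)F\le\hat F\le(1+\varepsilon)F$. *)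

theory Defs
  imports "HOL-Probability.Product_PMF"
begin

text \<open>Coordinator model.  Players are 0,...,alpha-1; player 0 is the coordinator.
  Player a holds a set v a (a subset of [n] = {1..n}).
  Communication is bit by bit. An event is (channel a, upward?, bit): on channel a
  (1 <= a < alpha) either player a sends a bit to the coordinator (upward = True)
  or the coordinator sends a bit to player a (upward = False).\<close>

type_synonym event = "nat \<times> bool \<times> bool"

record protocol =
  prot_sched :: "event list \<Rightarrow> (nat \<times> bool) option"
    \<comment> \<open>given the full transcript (known to the coordinator): stop, or next channel and direction\<close>
  prot_msg :: "nat \<Rightarrow> nat set \<Rightarrow> nat \<Rightarrow> event list \<Rightarrow> bool"
    \<comment> \<open>bit sent by player a, from its own input, its own private random seed and its local view\<close>
  prot_outp :: "nat set \<Rightarrow> nat \<Rightarrow> event list \<Rightarrow> real"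
    \<comment> \<open>coordinator's output from its input, its seed and the full transcript\<close>
  prot_coins :: "nat \<Rightarrow> nat pmf"
    \<comment> \<open>distribution of the private random seed of each player\<close>

definition local_view :: "nat \<Rightarrow> event list \<Rightarrow> event list" where
  "local_view a t = (if a = 0 then t else filter (\<lambda>e. fst e = a) t)"

fun run :: "protocol \<Rightarrow> nat \<Rightarrow> (nat \<Rightarrow> nat set) \<Rightarrow> (nat \<Rightarrow> nat) \<Rightarrow> nat \<Rightarrow> event list" where
  "run P \<alpha> v r 0 = []"
| "run P \<alpha> v r (Suc k) =
     (let t = run P \<alpha> v r k in
      case prot_sched P t of
        None \<Rightarrow> t
      | Some (a, up) \<Rightarrow>
          (if 0 < a \<and> a < \<alpha> then
             t @ [(a, up, if up then prot_msg P a (v a) (r a) (local_view a t)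
                          else prot_msg P 0 (v 0) (r 0) t)]
           else t))"

text \<open>The protocol halts with final transcript t (its length is the number of bits exchanged).\<close>
definition halts_with :: "protocol \<Rightarrow> nat \<Rightarrow> (nat \<Rightarrow> nat set) \<Rightarrow> (nat \<Rightarrow> nat) \<Rightarrow> event list \<Rightarrow> bool" where
  "halts_with P \<alpha> v r t \<longleftrightarrow> (\<exists>k. run P \<alpha> v r k = t \<and> run P \<alpha> v r (Suc k) = t)"

definition coin_dist :: "protocol \<Rightarrow> nat \<Rightarrow> (nat \<Rightarrow> nat) pmf" where
  "coin_dist P \<alpha> = Pi_pmf {..<\<alpha>} 0 (prot_coins P)"

definition F0 :: "nat \<Rightarrow> (nat \<Rightarrow> nat set) \<Rightarrow> nat" where
  "F0 \<alpha> v = card (\<Union>a<\<alpha>. v a)"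

definition collisions :: "nat \<Rightarrow> (nat \<Rightarrow> nat set) \<Rightarrow> nat" where
  "collisions \<alpha> v = card {(a, b, i). a < b \<and> b < \<alpha> \<and> i \<in> v a \<and> i \<in> v b}"

definition rel_approx :: "real \<Rightarrow> real \<Rightarrow> real \<Rightarrow> bool" where
  "rel_approx \<epsilon> F Fh \<longleftrightarrow> (1 - \<epsilon>) * F \<le> Fh \<and> Fh \<le> (1 + \<epsilon>) * F"

end

theory Submission
  imports Defs "HOL-Computational_Algebra.Primes"
begin

text \<open>The coordinator broadcasts the seed of a pairwise independent hash function \<open>h\<close> into
  \<open>{..<p}\<close>, where \<open>p > n\<close> is a prime of size polynomial in \<open>n\<close>.  An item has level \<open>j\<close> if
  \<open>j\<close> is least with \<open>h i < 2 ^ j\<close>.  Each player streams its items level by level, a single bit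
  marking the end of a level, which costs one bit per player and level and \<open>O(log n)\<close> bits per
  item.  The coordinator always reads from a player with the fewest completed levels and stops once
  \<open>T = \<Theta>(1 / \<epsilon>\<^sup>2)\<close> distinct items are known at completed levels, all levels are
  exhausted, or a budget of bits is used up.  It then knows the \<open>T\<close> smallest hash values of the
  union (or the whole union) and outputs \<open>T p / t\<close>, where \<open>t\<close> is the least bound with \<open>T\<close> hash
  values below it; Chebyshev's inequality gives the accuracy.

  Collisions enter only through the total load: by Cauchy--Schwarz, \<open>F\<close> distinct items with \<open>C\<close>
  pairwise collisions have at most \<open>F + sqrt (2 F C)\<close> occurrences.  Sampling at rate about
  \<open>T / F\<close> reduces this to \<open>O(T sqrt \<beta>)\<close> occurrences, by Markov's inequality; if
  \<open>F \<le> 1 / \<epsilon>\<^sup>2\<close>, all occurrences may be sent.\<close>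

section \<open>A prime of polynomial size\<close>

text \<open>The entries \<open>a m k = 1 / (m * (m - 1 choose k))\<close> of the Leibniz harmonic triangle satisfy
  \<open>a m (k + 1) = a (m - 1) k - a m k\<close>, so \<open>L * a m k\<close> is an integer by induction on \<open>k\<close>.\<close>

lemma leibniz_triangle_dvd:
  fixes L N :: nat
  assumes "\<And>m. 1 \<le> m \<Longrightarrow> m \<le> N \<Longrightarrow> m dvd L"
  shows "k < m \<Longrightarrow> m \<le> N \<Longrightarrow> m * ((m - 1) choose k) dvd L"
proof (induction k arbitrary: m)
  case 0
  then show ?case using assms by simp
next
  case (Suc k)
  obtain q where m: "m = Suc (Suc q)" "k \<le> q"
    using Suc.prems by (metis Suc_le_D Suc_le_eq less_Suc_eq_le)
  have "Suc q * (q choose k) dvd L" and "Suc (Suc q) * (Suc q choose k) dvd L"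
    using Suc.IH[of "Suc q"] Suc.IH[of "Suc (Suc q)"] Suc.prems m by auto
  \<comment> \<open>\<open>y\<close> and \<open>z\<close> are \<open>L\<close> times the triangle
    entries at \<open>(Suc q, k)\<close> and \<open>(Suc (Suc q), k)\<close>. By the recurrence
    their difference is \<open>L\<close> times the entry at \<open>(Suc (Suc q), Suc k)\<close>, so
    \<open>y - z\<close> is the cofactor sought; the rest clears denominators and passes to integers
    to allow the subtraction.\<close>
  then obtain y z where y: "L = Suc q * (q choose k) * y" and z: "L = Suc (Suc q) * (Suc q choose k) * z"
    unfolding dvd_def by blast
  define A B c c' d k' where
    "A = real (q choose k)" and "B = real (Suc q choose Suc k)" and "c = real (Suc q)"
    and "c' = real (Suc (Suc q))" and "d = real (Suc q - k)" and "k' = real (Suc k)"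
  note defs = this
  have pos: "A > 0" "c > 0" "k' > 0" and d: "d = c' - k'"
    using m by (simp_all add: defs of_nat_diff)
  have b1: "real (Suc q choose k) * d = c * A"
  proof -
    have "(Suc q - k) * (Suc q choose k) = Suc q * (q choose k)"
      using m binomial_absorb_comp[of "Suc q" k] by simp
    then have "real ((Suc q - k) * (Suc q choose k)) = real (Suc q * (q choose k))" by (rule arg_cong)
    then show ?thesis unfolding defs of_nat_mult by (simp only: mult.commute)
  qed
  have b2: "B * k' = c * A"
  proof -
    have "real (Suc k * (Suc q choose Suc k)) = real (Suc q * (q choose k))"
      by (rule arg_cong[OF Suc_times_binomial])
    then show ?thesis unfolding defs of_nat_mult by (simp only: mult.commute)
  qed
  have e1: "real L = c * A * y" unfolding y defs of_nat_mult ..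
  have e2: "real L = c' * real (Suc q choose k) * z" unfolding z defs of_nat_mult ..
  have "c * A * (y * d) = c' * (real (Suc q choose k) * d) * z"
    using e1 e2 by (simp add: mult_ac)
  also have "\<dots> = c * A * (c' * z)" unfolding b1 by (simp add: mult_ac)
  finally have e3: "y * d = c' * z" using pos by simp
  have "c' * B * (real y - real z) * k' = c' * (B * k') * (real y - real z)"
    by (simp add: mult_ac)
  also have "\<dots> = c * A * (c' * y - c' * z)" unfolding b2 by (simp add: algebra_simps)
  also have "\<dots> = c * A * y * k'" unfolding e3[symmetric] d by (simp add: algebra_simps)
  also have "\<dots> = real L * k'" unfolding e1 ..
  finally have "c' * B * (real y - real z) = real L" using pos by simp
  then have "real_of_int (int (Suc (Suc q) * (Suc q choose Suc k)) * (int y - int z)) = real_of_int (int L)"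
    unfolding defs by (simp only: of_int_mult of_int_diff of_int_of_nat_eq of_nat_mult)
  then have "int (Suc (Suc q) * (Suc q choose Suc k)) * (int y - int z) = int L"
    by (simp only: of_int_eq_iff)
  then have "int (Suc (Suc q) * (Suc q choose Suc k)) dvd int L" by (metis dvd_triv_left)
  then show ?case unfolding m by (simp only: int_dvd_int_iff diff_Suc_1)
qed

text \<open>The witness is the least common multiple of \<open>1..N\<close>: the product over the
  primes up to \<open>N\<close> of their largest powers not exceeding \<open>N\<close>. Each factor
  is at most \<open>N\<close>.\<close>

lemma common_multiple_le_power_card_primes:
  fixes N :: nat
  assumes "N \<ge> 1"
  obtains L where "L > 0" "L \<le> N ^ card {p. prime p \<and> p \<le> N}"
    "\<And>m. 1 \<le> m \<Longrightarrow> m \<le> N \<Longrightarrow> m dvd L"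
proof -
  let ?P = "{p. prime p \<and> p \<le> N}"
  have fin: "finite ?P" by (rule finite_subset[of _ "{..N}"]) auto
  define e where "e p = Max {k. p ^ k \<le> N}" for p :: nat
  have fe: "finite {k. p ^ k \<le> N}" if "p \<in> ?P" for p
  proof (rule finite_subset[of _ "{..N}"])
    have "p \<ge> 2" using that by (auto dest: prime_ge_2_nat)
    show "{k. p ^ k \<le> N} \<subseteq> {..N}"
    proof
      fix k assume "k \<in> {k. p ^ k \<le> N}"
      moreover have "k < p ^ k" using \<open>p \<ge> 2\<close> by (simp add: power_gt_expt)
      ultimately show "k \<in> {..N}" by simp
    qed
  qed auto
  have e_le: "p ^ e p \<le> N" if "p \<in> ?P" for p
  proof -
    have "0 \<in> {k. p ^ k \<le> N}" using assms by simp
    then have "e p \<in> {k. p ^ k \<le> N}" unfolding e_def using fe[OF that] by (intro Max_in) blast+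
    then show ?thesis by simp
  qed
  have e_ge: "k \<le> e p" if "p \<in> ?P" "p ^ k \<le> N" for p k
    unfolding e_def using fe[OF that(1)] that(2) by (intro Max_ge) auto
  define L where "L = (\<Prod>p\<in>?P. p ^ e p)"
  show ?thesis
  proof (rule that)
    show "L > 0" unfolding L_def by (intro prod_pos) (auto intro: prime_gt_0_nat)
    have "L \<le> (\<Prod>p\<in>?P. N)" unfolding L_def by (intro prod_mono) (use e_le in auto)
    then show "L \<le> N ^ card ?P" by simp
    show "m dvd L" if m: "1 \<le> m" "m \<le> N" for m
    proof -
      have sub: "prime_factors m \<subseteq> ?P"
        using m by (auto simp: in_prime_factors_iff dest!: dvd_imp_le)
      have "m = (\<Prod>p\<in>prime_factors m. p ^ multiplicity p m)"
        using prod_prime_factors[of m] m by simp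
      also have "\<dots> dvd (\<Prod>p\<in>prime_factors m. p ^ e p)"
      proof (intro prod_dvd_prod le_imp_power_dvd)
        fix p assume p: "p \<in> prime_factors m"
        have "p ^ multiplicity p m \<le> m" using m by (intro dvd_imp_le multiplicity_dvd) auto
        then show "multiplicity p m \<le> e p" using e_ge[of p] sub p m by auto
      qed
      also have "\<dots> dvd L" unfolding L_def using fin sub by (intro prod_dvd_prod_subset)
      finally show ?thesis .
    qed
  qed
qed

text \<open>Without such a prime, at most \<open>n\<close> primes lie below
  \<open>N = 8 * n^2 + 1\<close>, so \<open>1..N\<close> have a common multiple of size at most
  \<open>N^n\<close>. Writing \<open>N = 2 * m + 1\<close>, the Leibniz triangle makes it a multiple
  of \<open>N * (2 * m choose m)\<close>, which is at least \<open>4^m\<close> and hence too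
  large.\<close>

lemma exists_prime_between:
  fixes n :: nat
  assumes "n \<ge> 1"
  shows "\<exists>p. prime p \<and> n < p \<and> p \<le> 8 * n\<^sup>2 + 1"
proof (rule ccontr)
  assume neg: "\<not> ?thesis"
  \<comment> \<open>With this value \<open>(256^n)^n\<close> equals \<open>4^m\<close>, so the crude
    bound \<open>N < 256^n\<close> suffices for the contradiction.\<close>
  define m where "m = 4 * n\<^sup>2"
  define N where "N = 2 * m + 1"
  have N1: "N \<ge> 1" by (simp add: N_def)
  obtain L where L: "L > 0" "L \<le> N ^ card {p. prime p \<and> p \<le> N}"
    "\<And>q. 1 \<le> q \<Longrightarrow> q \<le> N \<Longrightarrow> q dvd L"
    using common_multiple_le_power_card_primes[OF N1] by blast
  have "N * ((2 * m) choose m) dvd L"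
    using leibniz_triangle_dvd[of N L m N] L(3) by (simp add: N_def)
  then have le: "N * ((2 * m) choose m) \<le> L" using L(1) by (intro dvd_imp_le)
  have "m > 0" using assms by (simp add: m_def)
  have "{p. prime p \<and> p \<le> N} \<subseteq> {1..n}"
  proof
    fix p assume "p \<in> {p. prime p \<and> p \<le> N}"
    then have "prime p" "p \<le> 8 * n\<^sup>2 + 1" by (simp_all add: N_def m_def)
    with neg have "p \<le> n" "1 \<le> p" by (auto simp: not_less dest: prime_gt_0_nat)
    then show "p \<in> {1..n}" by simp
  qed
  then have "card {p. prime p \<and> p \<le> N} \<le> n" using card_mono[of "{1..n}"] by fastforce
  then have "N ^ card {p. prime p \<and> p \<le> N} \<le> N ^ n" using N1 by (intro power_increasing)
  with L le have ub: "N * ((2 * m) choose m) \<le> N ^ n" by linarith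
  have "4 ^ m / (2 * real m) \<le> real ((2 * m) choose m)"
    using central_binomial_lower_bound[OF \<open>m > 0\<close>] .
  then have "4 ^ m \<le> 2 * real m * real ((2 * m) choose m)" using \<open>m > 0\<close> by (simp add: field_simps)
  also have "\<dots> \<le> real N * real ((2 * m) choose m)" by (intro mult_right_mono) (auto simp: N_def)
  also have "\<dots> \<le> real (N ^ n)" using ub by (metis of_nat_le_iff of_nat_mult)
  finally have "real (4 ^ m) \<le> real (N ^ n)" by simp
  then have "4 ^ m \<le> N ^ n" by (simp only: of_nat_le_iff)
  moreover have "N < 256 ^ n"
  proof -
    have "8 * n\<^sup>2 + 1 < 256 ^ n"
      using assms
    proof (induction n rule: nat_induct_at_least)
      case (Suc n)
      have "n \<le> n * n" using Suc by (cases n) auto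
      then have "8 * (Suc n)\<^sup>2 + 1 \<le> 256 * (8 * n\<^sup>2 + 1)"
        unfolding power2_eq_square mult_Suc mult_Suc_right distrib_left by linarith
      also have "\<dots> < 256 * 256 ^ n" using Suc.IH by (intro mult_strict_left_mono) auto
      finally show ?case by simp
    qed simp
    then show ?thesis by (simp add: N_def m_def)
  qed
  then have "N ^ n < (256 ^ n) ^ n" using assms by (intro power_strict_mono) auto
  moreover have "(256 ^ n) ^ n = (4::nat) ^ m"
  proof -
    have "(256 ^ n) ^ n = ((4::nat) ^ 4) ^ (n * n)" by (simp only: power_mult) simp
    also have "\<dots> = 4 ^ (4 * (n * n))" by (simp only: power_mult)
    finally show ?thesis by (simp only: m_def power2_eq_square)
  qed
  ultimately show False by linarith
qed

section \<open>Pairwise independent sampling\<close>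

text \<open>A seed below \<open>p * p\<close> packs slope and intercept into the single number that
  the coordinator draws and broadcasts.\<close>

definition affine_hash :: "nat \<Rightarrow> nat \<Rightarrow> nat \<Rightarrow> nat" where
  "affine_hash p s i = (s div p * i + s mod p) mod p"

lemma affine_hash_less: "p > 0 \<Longrightarrow> affine_hash p s i < p"
  by (simp add: affine_hash_def)

text \<open>An affine map over the field of \<open>p\<close> elements is determined by its values at
  two distinct points: subtracting the two congruences cancels the intercept, and
  \<open>x - y\<close> is not divisible by \<open>p\<close>. Injectivity suffices, as both sides
  have \<open>p * p\<close> elements.\<close>

lemma affine_hash_pair_bij:
  assumes p: "prime p" and x: "x < p" and y: "y < p" and "x \<noteq> y"
  shows "bij_betw (\<lambda>s. (affine_hash p s x, affine_hash p s y)) {..<p * p} ({..<p} \<times> {..<p})"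
proof -
  let ?f = "\<lambda>s. (affine_hash p s x, affine_hash p s y)"
  have p0: "p > 0" using p by (rule prime_gt_0_nat)
  have inj: "inj_on ?f {..<p * p}"
  proof (rule inj_onI)
    fix s s' assume s: "s \<in> {..<p * p}" "s' \<in> {..<p * p}" and eq: "?f s = ?f s'"
    define a b a' b' where "a = s div p" "b = s mod p" "a' = s' div p" "b' = s' mod p"
    note defs = this
    have lt: "a < p" "a' < p" "b < p" "b' < p"
      using s p0 by (auto simp: defs less_mult_imp_div_less)
    have e: "(a * z + b) mod p = (a' * z + b') mod p" if "z = x \<or> z = y" for z
      using eq that by (auto simp: affine_hash_def defs)
    have d: "int p dvd (int a * int z + int b) - (int a' * int z + int b')" if "z = x \<or> z = y" for z
    proof -
      have "int ((a * z + b) mod p) = int ((a' * z + b') mod p)" using e[OF that] by simp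
      then show ?thesis by (simp add: zmod_int mod_eq_dvd_iff)
    qed
    have "int p dvd ((int a * int x + int b) - (int a' * int x + int b'))
        - ((int a * int y + int b) - (int a' * int y + int b'))"
      by (rule dvd_diff[OF d d]) auto
    then have "int p dvd (int a - int a') * (int x - int y)" by (simp add: algebra_simps)
    then have "int p dvd (int a - int a') \<or> int p dvd (int x - int y)"
      using p by (simp add: prime_dvd_mult_iff)
    moreover have small: "u = w" if "int p dvd int u - int w" "u < p" "w < p" for u w
    proof (rule ccontr)
      assume "u \<noteq> w"
      then have "\<bar>int p\<bar> \<le> \<bar>int u - int w\<bar>" using that(1) by (intro dvd_imp_le_int) auto
      then show False using that(2,3) by linarith
    qed
    ultimately have "a = a'" using x y \<open>x \<noteq> y\<close> lt by blast
    moreover have "b = b'" using d[of x] small[of b b'] lt \<open>a = a'\<close> by simp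
    ultimately show "s = s'" unfolding defs by (metis div_mult_mod_eq)
  qed
  have "?f ` {..<p * p} = {..<p} \<times> {..<p}"
    using p0 inj by (intro card_subset_eq) (auto simp: affine_hash_less card_image card_cartesian_product)
  with inj show ?thesis by (simp add: bij_betw_def)
qed

text \<open>Pairwise independence in counting form: divided by \<open>p * p\<close>, the count is
  \<open>(t / p) * (u / p)\<close>.\<close>

lemma card_affine_hash_pair:
  assumes "prime p" "x < p" "y < p" "x \<noteq> y" "t \<le> p" "u \<le> p"
  shows "card {s \<in> {..<p * p}. affine_hash p s x < t \<and> affine_hash p s y < u} = t * u"
proof -
  let ?f = "\<lambda>s. (affine_hash p s x, affine_hash p s y)"
  note b = affine_hash_pair_bij[OF assms(1-4)]
  have "?f ` {s \<in> {..<p * p}. affine_hash p s x < t \<and> affine_hash p s y < u} = {..<t} \<times> {..<u}"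
  proof (intro equalityI subsetI)
    fix z assume "z \<in> {..<t} \<times> {..<u}"
    moreover from this have "z \<in> ?f ` {..<p * p}"
      using assms(5,6) bij_betw_imp_surj_on[OF b] by auto
    ultimately show "z \<in> ?f ` {s \<in> {..<p * p}. affine_hash p s x < t \<and> affine_hash p s y < u}" by auto
  qed auto
  moreover have "inj_on ?f {s \<in> {..<p * p}. affine_hash p s x < t \<and> affine_hash p s y < u}"
    using bij_betw_imp_inj_on[OF b] by (rule inj_on_subset) auto
  ultimately show ?thesis using card_image by fastforce
qed

lemma card_affine_hash:
  assumes "prime p" "x < p" "t \<le> p"
  shows "card {s \<in> {..<p * p}. affine_hash p s x < t} = t * p"
proof -
  have "p \<ge> 2" using assms(1) by (rule prime_ge_2_nat)
  \<comment> \<open>Any residue other than \<open>x\<close> serves as second point, since the bound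
    \<open>p\<close> on its hash value always holds.\<close>
  define y where "y = (if x = 0 then 1 else 0 :: nat)"
  have "card {s \<in> {..<p * p}. affine_hash p s x < t \<and> affine_hash p s y < p} = t * p"
    by (rule card_affine_hash_pair) (use assms \<open>p \<ge> 2\<close> in \<open>auto simp: y_def\<close>)
  then show ?thesis using \<open>p \<ge> 2\<close> by (simp add: affine_hash_less)
qed

text \<open>Pairwise independent indicators have vanishing covariances, so the variance of their sum
  is at most its mean. Summing over all seeds instead of averaging gives the factor
  \<open>p * p\<close>.\<close>

lemma sum_sample_deviation_le:
  fixes t :: nat
  assumes p: "prime p" and U: "U \<subseteq> {..<p}" and t: "t \<le> p"
  defines "\<mu> \<equiv> real (card U) * t / p"
  shows "(\<Sum>s<p * p. (real (card {i \<in> U. affine_hash p s i < t}) - \<mu>)\<^sup>2) \<le> real (p * p) * \<mu>"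
proof -
  have p0: "real p > 0" using prime_gt_0_nat[OF p] by simp
  have fin: "finite U" using U by (rule finite_subset) simp
  let ?F = "real (card U)"
  let ?I = "\<lambda>s i. of_bool (affine_hash p s i < t) :: real"
  let ?R = "\<lambda>s. \<Sum>i\<in>U. ?I s i"
  have R: "real (card {i \<in> U. affine_hash p s i < t}) = ?R s" for s
    using fin by (simp add: of_bool_def sum.If_cases Int_def)
  have one: "(\<Sum>s<p * p. ?I s i) = real t * p" if "i \<in> U" for i
  proof -
    have "(\<Sum>s<p * p. ?I s i) = real (card {s \<in> {..<p * p}. affine_hash p s i < t})"
      by (simp add: of_bool_def sum.If_cases Int_def)
    then show ?thesis using card_affine_hash[OF p _ t, of i] that U by auto
  qed
  have two: "(\<Sum>s<p * p. ?I s i * ?I s j) = (if i = j then real t * p else real t * t)"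
    if "i \<in> U" "j \<in> U" for i j
  proof (cases "i = j")
    case True
    then show ?thesis using one[OF that(1)] by (simp flip: of_bool_conj)
  next
    case False
    have "(\<Sum>s<p * p. ?I s i * ?I s j)
        = real (card {s \<in> {..<p * p}. affine_hash p s i < t \<and> affine_hash p s j < t})"
      by (simp add: sum.If_cases Int_def of_bool_def[of "_ \<and> _"] flip: of_bool_conj)
    also have "card {s \<in> {..<p * p}. affine_hash p s i < t \<and> affine_hash p s j < t} = t * t"
      using that U by (intro card_affine_hash_pair[OF p _ _ False t t]) auto
    finally show ?thesis using False by simp
  qed
  have S1: "(\<Sum>s<p * p. ?R s) = ?F * t * p"
  proof -
    have "(\<Sum>s<p * p. ?R s) = (\<Sum>i\<in>U. \<Sum>s<p * p. ?I s i)" by (rule sum.swap)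
    also have "\<dots> = (\<Sum>i\<in>U. real t * p)" by (intro sum.cong refl one)
    finally show ?thesis by simp
  qed
  have "(\<Sum>s<p * p. (?R s)\<^sup>2) = (\<Sum>s<p * p. \<Sum>i\<in>U. \<Sum>j\<in>U. ?I s i * ?I s j)"
    by (simp add: power2_eq_square sum_product)
  also have "\<dots> = (\<Sum>i\<in>U. \<Sum>j\<in>U. \<Sum>s<p * p. ?I s i * ?I s j)"
    by (subst sum.swap, rule sum.cong[OF refl], rule sum.swap)
  also have "\<dots> = (\<Sum>i\<in>U. \<Sum>j\<in>U. (if i = j then real t * p else real t * t))"
    using two by (intro sum.cong refl) auto
  \<comment> \<open>Adding \<open>t * t\<close> on the diagonal as well completes the square of the
    mean; this is why the variance bound is an inequality.\<close>
  also have "\<dots> \<le> (\<Sum>i\<in>U. \<Sum>j\<in>U. (if i = j then real t * p else 0) + real t * t)"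
    by (intro sum_mono) auto
  also have "\<dots> = ?F * t * p + ?F\<^sup>2 * (real t)\<^sup>2"
    using fin by (simp add: sum.distrib power2_eq_square distrib_left mult_ac)
  finally have S2: "(\<Sum>s<p * p. (?R s)\<^sup>2) \<le> ?F * t * p + ?F\<^sup>2 * (real t)\<^sup>2" .
  have "(\<Sum>s<p * p. (?R s - \<mu>)\<^sup>2) = (\<Sum>s<p * p. (?R s)\<^sup>2) - 2 * \<mu> * (\<Sum>s<p * p. ?R s) + real (p * p) * \<mu>\<^sup>2"
    by (simp add: power2_diff sum.distrib sum_subtractf sum_distrib_left mult_ac)
  also have "\<dots> \<le> ?F * t * p + ?F\<^sup>2 * (real t)\<^sup>2 - 2 * \<mu> * (?F * t * p) + real (p * p) * \<mu>\<^sup>2"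
    using S1 S2 by simp
  also have "\<dots> = real (p * p) * \<mu>"
    using p0 by (simp add: \<mu>_def field_simps power2_eq_square)
  finally show ?thesis by (simp only: R)
qed

text \<open>Chebyshev's inequality for the number of sampled items, with seeds counted instead of
  probabilities.\<close>

lemma card_sample_deviation_le:
  fixes t :: nat and \<delta> :: real
  assumes p: "prime p" and U: "U \<subseteq> {..<p}" and t: "t \<le> p" and \<delta>: "\<delta> > 0"
  defines "\<mu> \<equiv> real (card U) * t / p"
  shows "real (card {s \<in> {..<p * p}. \<bar>real (card {i \<in> U. affine_hash p s i < t}) - \<mu>\<bar> \<ge> \<delta>})
    \<le> real (p * p) * (\<mu> / \<delta>\<^sup>2)"
proof -
  let ?d = "\<lambda>s. real (card {i \<in> U. affine_hash p s i < t}) - \<mu>"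
  let ?B = "{s \<in> {..<p * p}. \<bar>?d s\<bar> \<ge> \<delta>}"
  have "real (card ?B) * \<delta>\<^sup>2 = (\<Sum>s\<in>?B. \<delta>\<^sup>2)" by simp
  also have "\<dots> \<le> (\<Sum>s\<in>?B. (?d s)\<^sup>2)"
    using \<delta> by (intro sum_mono) (auto simp: abs_le_square_iff[symmetric])
  also have "\<dots> \<le> (\<Sum>s<p * p. (?d s)\<^sup>2)" by (intro sum_mono2) auto
  also have "\<dots> \<le> real (p * p) * \<mu>"
    unfolding \<mu>_def by (rule sum_sample_deviation_le[OF p U t])
  finally show ?thesis using \<delta> by (simp add: field_simps)
qed

text \<open>Markov's inequality for the sampled occurrences, counted once per player holding the
  item. Their mean is \<open>t / p\<close> times the total load.\<close>

lemma card_sample_load_ge: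
  fixes t :: nat and B :: real
  assumes p: "prime p" and v: "\<And>a. a \<in> A \<Longrightarrow> v a \<subseteq> {..<p}" and t: "t \<le> p" and B: "B > 0"
  shows "real (card {s \<in> {..<p * p}. real (\<Sum>a\<in>A. card {i \<in> v a. affine_hash p s i < t}) \<ge> B})
    \<le> real (p * p) * (real (\<Sum>a\<in>A. card (v a)) * t / p / B)"
proof -
  have p0: "real p > 0" using prime_gt_0_nat[OF p] by simp
  let ?M = "\<lambda>s. \<Sum>a\<in>A. real (card {i \<in> v a. affine_hash p s i < t})"
  let ?B = "{s \<in> {..<p * p}. ?M s \<ge> B}"
  have fin: "finite (v a)" if "a \<in> A" for a using v[OF that] by (rule finite_subset) simp
  have "real (card ?B) * B = (\<Sum>s\<in>?B. B)" by simp
  also have "\<dots> \<le> (\<Sum>s\<in>?B. ?M s)" by (intro sum_mono) auto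
  also have "\<dots> \<le> (\<Sum>s<p * p. ?M s)" by (intro sum_mono2) (auto intro!: sum_nonneg)
  also have "\<dots> = (\<Sum>a\<in>A. \<Sum>s<p * p. real (card {i \<in> v a. affine_hash p s i < t}))"
    by (rule sum.swap)
  also have "\<dots> = (\<Sum>a\<in>A. real (card (v a)) * (real t * p))"
  proof (rule sum.cong[OF refl])
    fix a assume a: "a \<in> A"
    have "(\<Sum>s<p * p. real (card {i \<in> v a. affine_hash p s i < t}))
        = (\<Sum>s<p * p. \<Sum>i\<in>v a. of_bool (affine_hash p s i < t))"
      using fin[OF a] by (simp add: of_bool_def sum.If_cases Int_def)
    also have "\<dots> = (\<Sum>i\<in>v a. \<Sum>s<p * p. of_bool (affine_hash p s i < t))"
      by (rule sum.swap)
    also have "\<dots> = (\<Sum>i\<in>v a. real (card {s \<in> {..<p * p}. affine_hash p s i < t}))"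
      by (simp add: of_bool_def sum.If_cases Int_def)
    also have "\<dots> = (\<Sum>i\<in>v a. real t * p)"
      using card_affine_hash[OF p _ t] v[OF a] by (intro sum.cong refl) auto
    finally show "(\<Sum>s<p * p. real (card {i \<in> v a. affine_hash p s i < t})) = real (card (v a)) * (real t * p)"
      by simp
  qed
  also have "\<dots> = real (\<Sum>a\<in>A. card (v a)) * (real t * p)" by (simp add: sum_distrib_right)
  finally have "real (card ?B) * B \<le> real (\<Sum>a\<in>A. card (v a)) * (real t * p)" .
  then show ?thesis using B p0 by (simp add: field_simps)
qed

section \<open>The level streaming protocol\<close>

definition nat_bits :: "nat \<Rightarrow> nat \<Rightarrow> bool list" where
  "nat_bits k x = map (bit x) [0..<k]"

definition bits_nat :: "bool list \<Rightarrow> nat" where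
  "bits_nat = horner_sum of_bool 2"

lemma length_nat_bits [simp]: "length (nat_bits k x) = k"
  by (simp add: nat_bits_def)

lemma bits_nat_nat_bits: "x < 2 ^ k \<Longrightarrow> bits_nat (nat_bits k x) = x"
  by (simp add: bits_nat_def nat_bits_def horner_sum_bit_eq_take_bit take_bit_nat_eq_self)

text \<open>\<open>True\<close> announces an item of \<open>w\<close> bits, and \<open>False\<close>
  in the same position will end the level. The stream is thus self-delimiting, and the bits received
  determine the state of the reader.\<close>

definition level_items :: "nat \<Rightarrow> (nat \<Rightarrow> nat) \<Rightarrow> nat set \<Rightarrow> nat \<Rightarrow> bool list" where
  "level_items w g X d = concat (map (\<lambda>i. True # nat_bits w i) (sorted_list_of_set {i \<in> X. g i = d}))"

definition level_stream :: "nat \<Rightarrow> (nat \<Rightarrow> nat) \<Rightarrow> nat set \<Rightarrow> nat \<Rightarrow> bool list" where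
  "level_stream w g X m = concat (map (\<lambda>d. level_items w g X d @ [False]) [0..<m])"

lemma level_stream_0 [simp]: "level_stream w g X 0 = []"
  by (simp add: level_stream_def)

lemma level_stream_Suc:
  "level_stream w g X (Suc m) = level_stream w g X m @ level_items w g X m @ [False]"
  by (simp add: level_stream_def)

lemma length_level_stream:
  assumes "finite X"
  shows "length (level_stream w g X m) = m + (w + 1) * card {i \<in> X. g i < m}"
proof (induction m)
  case (Suc m)
  have "length (level_items w g X m) = (\<Sum>i\<leftarrow>sorted_list_of_set {i \<in> X. g i = m}. w + 1)"
    by (simp add: level_items_def length_concat comp_def)
  also have "\<dots> = (w + 1) * card {i \<in> X. g i = m}"
    by (simp add: sum_list_triv)
  finally have "length (level_items w g X m) = (w + 1) * card {i \<in> X. g i = m}" .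
  moreover have "card {i \<in> X. g i < Suc m} = card {i \<in> X. g i < m} + card {i \<in> X. g i = m}"
    using assms by (subst card_Un_disjoint[symmetric]) (auto intro!: arg_cong[of _ _ card])
  ultimately show ?case using Suc by (simp add: level_stream_Suc algebra_simps)
qed simp

lemma level_stream_prefix:
  assumes "m \<le> K"
  obtains zs where "level_stream w g X K = level_stream w g X m @ zs"
proof -
  have "[0..<K] = [0..<m] @ [m..<K]" using assms by (metis le_Suc_ex upt_add_eq_append zero_le)
  then show ?thesis using that by (simp add: level_stream_def)
qed

text \<open>A parser state consists of the number of completed levels, the bits read of a pending
  item (including its leading marker), and the items read so far, tagged with their level.\<close>

type_synonym parser_state = "nat \<times> bool list \<times> (nat \<times> nat) set"

text \<open>The pending list includes the marker, so at length \<open>w\<close> it holds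
  \<open>w - 1\<close> bits of the item and \<open>b\<close> is the last one.\<close>

fun feed :: "nat \<Rightarrow> parser_state \<Rightarrow> bool \<Rightarrow> parser_state" where
  "feed w (d, pend, I) b =
    (if pend = [] then (if b then (d, [True], I) else (Suc d, [], I))
     else if length pend < w then (d, pend @ [b], I)
     else (d, [], insert (d, bits_nat (tl pend @ [b])) I))"

definition parse :: "nat \<Rightarrow> bool list \<Rightarrow> parser_state" where
  "parse w bs = foldl (feed w) (0, [], {}) bs"

section \<open>Parsing prefixes of a level stream\<close>

lemma feed_mono:
  "fst st \<le> fst (feed w st b) \<and> snd (snd st) \<subseteq> snd (snd (feed w st b))"
  by (cases st) auto

lemma foldl_feed_mono:
  "fst st \<le> fst (foldl (feed w) st bs) \<and> snd (snd st) \<subseteq> snd (snd (foldl (feed w) st bs))"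
proof (induction bs arbitrary: st)
  case (Cons b bs)
  show ?case using Cons[of "feed w st b"] feed_mono[of st w b] by force
qed simp

lemma parse_append_mono:
  "fst (parse w xs) \<le> fst (parse w (xs @ ys))"
  "snd (snd (parse w xs)) \<subseteq> snd (snd (parse w (xs @ ys)))"
  using foldl_feed_mono[of "parse w xs" w ys] by (simp_all add: parse_def)

lemma foldl_feed_pending:
  assumes "pend \<noteq> []" "bs \<noteq> []" "length pend + length bs = Suc w"
  shows "foldl (feed w) (d, pend, I) bs = (d, [], insert (d, bits_nat (tl (pend @ bs))) I)"
  using assms
proof (induction bs arbitrary: pend)
  case (Cons b bs)
  then show ?case using Cons.IH[of "pend @ [b]"] by (cases "bs = []") auto
qed simp

lemma foldl_feed_items:
  assumes "w \<ge> 1" "\<forall>i\<in>set is. i < 2 ^ w"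
  shows "foldl (feed w) (d, [], I) (concat (map (\<lambda>i. True # nat_bits w i) is)) = (d, [], I \<union> Pair d ` set is)"
  using assms(2)
proof (induction "is" arbitrary: I)
  case (Cons i "is")
  \<comment> \<open>The parser records an item only on reading its last payload bit, so an item must
    have at least one.\<close>
  have "nat_bits w i \<noteq> []" using assms(1) by (metis length_nat_bits list.size(3) not_one_le_zero)
  then have "foldl (feed w) (d, [], I) (True # nat_bits w i) = (d, [], insert (d, i) I)"
    using foldl_feed_pending[of "[True]" "nat_bits w i" w d I] Cons.prems
    by (simp add: bits_nat_nat_bits)
  then show ?case using Cons by simp
qed simp

text \<open>The second claim says that all items of level \<open>m\<close> do not yet complete it;
  only the end marker does.\<close>

lemma parse_level_stream_items:
  assumes "w \<ge> 1" "finite X" "\<forall>i\<in>X. i < 2 ^ w"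
  shows "parse w (level_stream w g X m) = (m, [], {(d, i). i \<in> X \<and> g i = d \<and> d < m})"
    and "fst (parse w (level_stream w g X m @ level_items w g X m)) = m"
proof -
  have step: "foldl (feed w) (m, [], I) (level_items w g X m) = (m, [], I \<union> Pair m ` {i \<in> X. g i = m})" for m I
    unfolding level_items_def using assms by (subst foldl_feed_items) auto
  show *: "parse w (level_stream w g X m) = (m, [], {(d, i). i \<in> X \<and> g i = d \<and> d < m})"
  proof (induction m)
    case (Suc m)
    then show ?case by (auto simp: parse_def level_stream_Suc step)
  qed (simp add: parse_def)
  show "fst (parse w (level_stream w g X m @ level_items w g X m)) = m"
    using * step by (simp add: parse_def)
qed

context
  fixes w :: nat and g :: "nat \<Rightarrow> nat" and X :: "nat set" and K :: nat
  assumes w: "w \<ge> 1" and X: "finite X" "\<forall>i\<in>X. i < 2 ^ w"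
begin

text \<open>Level \<open>q\<close> counts as complete exactly when its end marker has been read. A
  shorter prefix lies within the stream up to the last item of level \<open>q\<close>, where the
  counter still shows \<open>q\<close>, and the counter never decreases.\<close>

lemma parse_take_levels:
  assumes "m \<le> K"
  shows "m \<le> fst (parse w (take l (level_stream w g X K))) \<longleftrightarrow> length (level_stream w g X m) \<le> l"
proof
  obtain zs where zs: "level_stream w g X K = level_stream w g X m @ zs"
    using level_stream_prefix[OF assms] .
  assume "length (level_stream w g X m) \<le> l"
  then show "m \<le> fst (parse w (take l (level_stream w g X K)))"
    using parse_append_mono(1)[of w "level_stream w g X m" "take (l - length (level_stream w g X m)) zs"]
    by (simp add: zs parse_level_stream_items(1)[OF w X])
next
  obtain zs where zs: "level_stream w g X K = level_stream w g X m @ zs"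
    using level_stream_prefix[OF assms] .
  assume le: "m \<le> fst (parse w (take l (level_stream w g X K)))"
  show "length (level_stream w g X m) \<le> l"
  proof (rule ccontr)
    assume l: "\<not> ?thesis"
    then obtain q where m: "m = Suc q" by (cases m) auto
    let ?ys = "level_stream w g X q @ level_items w g X q"
    have "length ?ys \<ge> l" using l by (simp add: m level_stream_Suc)
    then have "take l (level_stream w g X K) = take l ?ys"
      by (simp add: zs m level_stream_Suc)
    then have "fst (parse w (take l (level_stream w g X K))) \<le> fst (parse w ?ys)"
      using parse_append_mono(1)[of w "take l ?ys" "drop l ?ys"] by (metis append_take_drop_id)
    then show False using le by (simp add: m parse_level_stream_items(2)[OF w X])
  qed
qed

text \<open>A cut-off item stays pending and recorded items are never revised, so a prefix records
  nothing that the whole stream does not.\<close>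

lemma parse_take_items_sound:
  assumes "(d, i) \<in> snd (snd (parse w (take l (level_stream w g X K))))"
  shows "i \<in> X" "g i = d"
proof -
  let ?W = "level_stream w g X K"
  have "(d, i) \<in> snd (snd (parse w ?W))"
    using parse_append_mono(2)[of w "take l ?W" "drop l ?W"] assms by auto
  then show "i \<in> X" "g i = d" by (auto simp: parse_level_stream_items(1)[OF w X])
qed

lemma parse_take_items_complete:
  assumes "m \<le> K" "length (level_stream w g X m) \<le> l" "i \<in> X" "g i < m"
  shows "(g i, i) \<in> snd (snd (parse w (take l (level_stream w g X K))))"
proof -
  obtain zs where zs: "level_stream w g X K = level_stream w g X m @ zs"
    using level_stream_prefix[OF assms(1)] .
  have "(g i, i) \<in> snd (snd (parse w (level_stream w g X m)))"
    using assms by (simp add: parse_level_stream_items(1)[OF w X])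
  then show ?thesis
    using assms(2) parse_append_mono(2)[of w "level_stream w g X m" "take (l - length (level_stream w g X m)) zs"]
    by (auto simp: zs)
qed

end

section \<open>Transcripts and the definition of the protocol\<close>

definition down_bits :: "nat \<Rightarrow> event list \<Rightarrow> bool list" where
  "down_bits a t = map (snd \<circ> snd) (filter (\<lambda>e. fst e = a \<and> \<not> fst (snd e)) t)"

definition up_bits :: "nat \<Rightarrow> event list \<Rightarrow> bool list" where
  "up_bits a t = map (snd \<circ> snd) (filter (\<lambda>e. fst e = a \<and> fst (snd e)) t)"

lemma down_bits_simps [simp]:
  "down_bits a [] = []"
  "down_bits a (t @ [(b, up, x)]) = down_bits a t @ (if b = a \<and> \<not> up then [x] else [])"
  by (auto simp: down_bits_def)

lemma up_bits_simps [simp]: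
  "up_bits a [] = []"
  "up_bits a (t @ [(b, up, x)]) = up_bits a t @ (if b = a \<and> up then [x] else [])"
  by (auto simp: up_bits_def)

text \<open>A player sees only its own channel; the seed and the position in its stream, which it
  reads off there, agree with those in the full transcript.\<close>

lemma bits_local_view:
  assumes "a \<noteq> 0"
  shows "down_bits a (local_view a t) = down_bits a t" "up_bits a (local_view a t) = up_bits a t"
  using assms by (auto simp: down_bits_def up_bits_def local_view_def intro!: arg_cong[of _ _ "map _"] filter_cong)

text \<open>\<open>D\<close> is the number of seed bits sent to each player, \<open>w\<close> the
  width of an item, \<open>K\<close> the number of levels, \<open>T\<close> the number of distinct
  items wanted and \<open>L\<close> the bit budget. \<open>g\<close> assigns levels depending on the
  seed, and \<open>est\<close> turns the seed and the known items into the output.\<close>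

locale level_protocol =
  fixes \<alpha> D w K T L :: nat
    and g :: "nat \<Rightarrow> nat \<Rightarrow> nat"
    and est :: "nat \<Rightarrow> nat set \<Rightarrow> real"
    and coins :: "nat \<Rightarrow> nat pmf"
  assumes w_pos: "w \<ge> 1"
begin

definition items :: "event list \<Rightarrow> nat \<Rightarrow> (nat \<times> nat) set" where
  "items t a = snd (snd (parse w (up_bits a t)))"

definition levels_done :: "event list \<Rightarrow> nat \<Rightarrow> nat" where
  "levels_done t a = fst (parse w (up_bits a t))"

text \<open>The tags restrict the count to levels that every player has finished. There the union is
  known completely, whereas items of a half-read level would form a biased sample.\<close>

definition enough :: "event list \<Rightarrow> nat \<Rightarrow> bool" where
  "enough t m \<longleftrightarrow> m \<le> K \<and> (\<forall>a\<in>{1..<\<alpha>}. m \<le> levels_done t a) \<and>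
    (m = K \<or> T \<le> card {i. \<exists>a\<in>{1..<\<alpha>}. \<exists>d<m. (d, i) \<in> items t a})"

text \<open>The message function is not told the channel, so the coordinator must recover from the
  transcript which player the next seed bit is for.\<close>

definition seed_target :: "event list \<Rightarrow> nat" where
  "seed_target t = (LEAST a. a \<in> {1..<\<alpha>} \<and> length (down_bits a t) < D)"

text \<open>The schedule may not depend on the coordinator's own input, so only items of the other
  players are counted in \<open>enough\<close>.\<close>

definition sched :: "event list \<Rightarrow> (nat \<times> bool) option" where
  "sched t =
    (if L \<le> length t then None
     else if \<exists>a\<in>{1..<\<alpha>}. length (down_bits a t) < D then Some (seed_target t, False)
     else if \<exists>m. enough t m then None
     else Some (arg_min_on (levels_done t) {1..<\<alpha>}, True))"

text \<open>Shared randomness comes from the coordinator's seed, which a player decodes from its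
  downward bits. The schedule asks for upward bits only after the seed has been sent to all
  players.\<close>

definition msg :: "nat \<Rightarrow> nat set \<Rightarrow> nat \<Rightarrow> event list \<Rightarrow> bool" where
  "msg a X s t =
    (if a = 0 then bit s (length (down_bits (seed_target t) t))
     else level_stream w (g (bits_nat (down_bits a t))) X K ! length (up_bits a t))"

text \<open>The coordinator's own set is added without communication. The resulting set may include
  items of unfinished levels; \<open>bottom_estimate_cong\<close> shows that these do not affect the
  estimate used later.\<close>

definition outp :: "nat set \<Rightarrow> nat \<Rightarrow> event list \<Rightarrow> real" where
  "outp X s t = est s (X \<union> {i. \<exists>a\<in>{1..<\<alpha>}. \<exists>d. (d, i) \<in> items t a})"

definition prot :: protocol where
  "prot = \<lparr>prot_sched = sched, prot_msg = msg, prot_outp = outp, prot_coins = coins\<rparr>"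

lemma prot_simps [simp]:
  "prot_sched prot = sched" "prot_msg prot = msg" "prot_outp prot = outp" "prot_coins prot = coins"
  by (simp_all add: prot_def)

section \<open>Runs on a fixed input and fixed seeds\<close>

context
  fixes v :: "nat \<Rightarrow> nat set" and r :: "nat \<Rightarrow> nat"
  assumes seed: "r 0 < 2 ^ D"
    and fin: "\<And>a. a < \<alpha> \<Longrightarrow> finite (v a)"
    and small: "\<And>a i. a < \<alpha> \<Longrightarrow> i \<in> v a \<Longrightarrow> i < 2 ^ w"
begin

definition W :: "nat \<Rightarrow> nat \<Rightarrow> bool list" where
  "W a m = level_stream w (g (r 0)) (v a) m"

text \<open>Invariant of reachable transcripts: every channel carries a prefix of the seed downwards
  and a prefix of the player's stream upwards. The length equation lets the cost be bounded channel
  by channel.\<close>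

definition faithful :: "event list \<Rightarrow> bool" where
  "faithful t \<longleftrightarrow>
    (\<forall>a\<in>{1..<\<alpha>}. down_bits a t = take (length (down_bits a t)) (nat_bits D (r 0)) \<and>
       up_bits a t = take (length (up_bits a t)) (W a K)) \<and>
    length t = (\<Sum>a\<in>{1..<\<alpha>}. length (down_bits a t) + length (up_bits a t))"

lemma levels_done_iff:
  assumes "faithful t" "a \<in> {1..<\<alpha>}" "m \<le> K"
  shows "m \<le> levels_done t a \<longleftrightarrow> length (W a m) \<le> length (up_bits a t)"
proof -
  have "up_bits a t = take (length (up_bits a t)) (W a K)"
    using assms by (simp add: faithful_def)
  then show ?thesis
    using parse_take_levels[OF w_pos _ _ assms(3), of "v a" "length (up_bits a t)" "g (r 0)"]
      assms(2) fin[of a] small[of a] unfolding levels_done_def W_def by auto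
qed

lemma items_sound:
  assumes "faithful t" "a \<in> {1..<\<alpha>}" "(d, i) \<in> items t a"
  shows "i \<in> v a" "g (r 0) i = d"
proof -
  have "up_bits a t = take (length (up_bits a t)) (W a K)"
    using assms by (simp add: faithful_def)
  then have "(d, i) \<in> snd (snd (parse w (take (length (up_bits a t)) (W a K))))"
    using assms(3) by (simp add: items_def)
  then show "i \<in> v a" "g (r 0) i = d"
    using parse_take_items_sound[OF w_pos, of "v a" d i "length (up_bits a t)" "g (r 0)" K]
      assms(2) fin[of a] small[of a] by (auto simp: W_def)
qed

lemma items_complete:
  assumes "faithful t" "a \<in> {1..<\<alpha>}" "m \<le> K" "m \<le> levels_done t a" "i \<in> v a" "g (r 0) i < m"
  shows "(g (r 0) i, i) \<in> items t a"
proof -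
  have "up_bits a t = take (length (up_bits a t)) (W a K)"
    using assms by (simp add: faithful_def)
  moreover have "length (W a m) \<le> length (up_bits a t)"
    using levels_done_iff assms by blast
  ultimately show ?thesis
    using parse_take_items_complete[OF w_pos, of "v a" m K "g (r 0)" "length (up_bits a t)" i]
      assms fin[of a] small[of a] by (auto simp: W_def items_def)
qed

text \<open>At levels completed by all, the coordinator knows exactly the items of the other
  players, so the test in \<open>enough\<close> measures the true sample.\<close>

lemma tagged_items_eq:
  assumes "faithful t" "m \<le> K" "\<forall>a\<in>{1..<\<alpha>}. m \<le> levels_done t a"
  shows "{i. \<exists>a\<in>{1..<\<alpha>}. \<exists>d<m. (d, i) \<in> items t a} = {i \<in> (\<Union>a\<in>{1..<\<alpha>}. v a). g (r 0) i < m}"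
  using items_sound[OF assms(1)] items_complete[OF assms(1) _ assms(2)] assms(3) by blast

lemma enoughI:
  assumes "faithful t" "m \<le> K" "\<forall>a\<in>{1..<\<alpha>}. m \<le> levels_done t a"
    "m = K \<or> T \<le> card {i \<in> (\<Union>a\<in>{1..<\<alpha>}. v a). g (r 0) i < m}"
  shows "enough t m"
  using assms(2-) unfolding enough_def tagged_items_eq[OF assms(1-3)] by blast

lemma sched_down:
  assumes "sched t = Some (a, False)" "faithful t"
  shows "a = seed_target t" "a \<in> {1..<\<alpha>}" "length (down_bits a t) < D"
proof -
  have ex: "\<exists>a. a \<in> {1..<\<alpha>} \<and> length (down_bits a t) < D" and a: "a = seed_target t"
    using assms by (auto simp: sched_def split: if_splits)
  show "a = seed_target t" by fact
  show "a \<in> {1..<\<alpha>}" "length (down_bits a t) < D"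
    using LeastI_ex[OF ex] unfolding a seed_target_def by blast+
qed

text \<open>Here \<open>m\<close> is any number of levels after which stopping is allowed. If the
  player with the fewest completed levels had finished \<open>m\<close> of them, so would all, and
  \<open>enough\<close> would have stopped the run. Hence no player is asked for bits beyond its
  first \<open>m\<close> levels.\<close>

lemma sched_up:
  assumes "sched t = Some (a, True)" "faithful t" and m: "m \<le> K"
    "m = K \<or> T \<le> card {i \<in> (\<Union>a\<in>{1..<\<alpha>}. v a). g (r 0) i < m}"
  shows "a \<in> {1..<\<alpha>}" "down_bits a t = nat_bits D (r 0)" "length (up_bits a t) < length (W a m)"
proof -
  have full: "\<forall>a\<in>{1..<\<alpha>}. D \<le> length (down_bits a t)" and ne: "\<not> enough t m"
    and a: "a = arg_min_on (levels_done t) {1..<\<alpha>}"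
    using assms(1) by (auto simp: sched_def not_less split: if_splits)
  have notall: "\<not> (\<forall>b\<in>{1..<\<alpha>}. m \<le> levels_done t b)"
    using enoughI[OF assms(2) m(1) _ m(2)] ne by blast
  then have nonempty: "{1..<\<alpha>} \<noteq> {}" by blast
  show aA: "a \<in> {1..<\<alpha>}" unfolding a by (rule arg_min_if_finite(1)[OF _ nonempty]) simp
  have min: "levels_done t a \<le> levels_done t b" if "b \<in> {1..<\<alpha>}" for b
    unfolding a by (rule arg_min_least[OF _ nonempty that]) simp
  have "\<not> m \<le> levels_done t a" using notall min by fastforce
  then show "length (up_bits a t) < length (W a m)"
    using levels_done_iff[OF assms(2) aA m(1)] by simp
  have "down_bits a t = take (length (down_bits a t)) (nat_bits D (r 0))"
    using assms(2) aA by (simp add: faithful_def)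
  then show "down_bits a t = nat_bits D (r 0)" using full aA by simp
qed

lemma W_mono: "m \<le> K \<Longrightarrow> length (W a m) \<le> length (W a K)"
  unfolding W_def by (metis length_append level_stream_prefix le_add1)

lemma faithful_snoc:
  assumes "faithful t" "b \<in> {1..<\<alpha>}"
    "if up then length (up_bits b t) < length (W b K) \<and> x = W b K ! length (up_bits b t)
     else length (down_bits b t) < D \<and> x = bit (r 0) (length (down_bits b t))"
  shows "faithful (t @ [(b, up, x)])"
proof -
  let ?t = "t @ [(b, up, x)]"
  have "down_bits a ?t = take (length (down_bits a ?t)) (nat_bits D (r 0)) \<and>
       up_bits a ?t = take (length (up_bits a ?t)) (W a K)" if a: "a \<in> {1..<\<alpha>}" for a
  proof -
    have "down_bits a t = take (length (down_bits a t)) (nat_bits D (r 0))"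
       "up_bits a t = take (length (up_bits a t)) (W a K)"
      using assms(1) a by (simp_all add: faithful_def)
    then show ?thesis
      using assms(3) by (cases up; cases "b = a") (simp_all add: take_Suc_conv_app_nth nat_bits_def)
  qed
  moreover have "length ?t = (\<Sum>a\<in>{1..<\<alpha>}. length (down_bits a ?t) + length (up_bits a ?t))"
  proof -
    have "(\<Sum>a\<in>{1..<\<alpha>}. length (down_bits a ?t) + length (up_bits a ?t))
       = (\<Sum>a\<in>{1..<\<alpha>}. (length (down_bits a t) + length (up_bits a t)) + (if a = b then 1 else 0))"
      by (intro sum.cong) auto
    also have "\<dots> = length t + 1"
      using assms(1,2) by (simp add: sum.distrib faithful_def)
    finally show ?thesis by simp
  qed
  ultimately show ?thesis unfolding faithful_def by blast
qed

lemma run_step: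
  assumes "faithful t" "sched t = Some (a, up)" and m: "m \<le> K"
    "m = K \<or> T \<le> card {i \<in> (\<Union>a\<in>{1..<\<alpha>}. v a). g (r 0) i < m}"
  defines "x \<equiv> if up then msg a (v a) (r a) (local_view a t) else msg 0 (v 0) (r 0) t"
  assumes bd: "\<And>b. b \<in> {1..<\<alpha>} \<Longrightarrow> length (up_bits b t) \<le> length (W b m)"
  shows "a \<in> {1..<\<alpha>}" "faithful (t @ [(a, up, x)])"
    "\<And>b. b \<in> {1..<\<alpha>} \<Longrightarrow> length (up_bits b (t @ [(a, up, x)])) \<le> length (W b m)"
proof -
  have *: "a \<in> {1..<\<alpha>} \<and> faithful (t @ [(a, up, x)]) \<and>
    (\<forall>b\<in>{1..<\<alpha>}. length (up_bits b (t @ [(a, up, x)])) \<le> length (W b m))"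
  proof (cases up)
    case True
    then have s: "sched t = Some (a, True)" using assms(2) by simp
    note u = sched_up[OF s assms(1) m]
    have "x = W a K ! length (up_bits a t)"
      using True u(1,2) seed by (simp add: x_def msg_def W_def bits_local_view bits_nat_nat_bits)
    moreover have "length (up_bits a t) < length (W a K)" using u(3) W_mono[OF m(1), of a] by linarith
    ultimately show ?thesis using True u bd by (auto intro!: faithful_snoc assms(1))
  next
    case False
    then have s: "sched t = Some (a, False)" using assms(2) by simp
    note u = sched_down[OF s assms(1)]
    have "x = bit (r 0) (length (down_bits a t))" using False u(1) by (simp add: x_def msg_def)
    then show ?thesis using False u(2,3) bd by (auto intro!: faithful_snoc assms(1))
  qed
  show "a \<in> {1..<\<alpha>}" "faithful (t @ [(a, up, x)])"
    "\<And>b. b \<in> {1..<\<alpha>} \<Longrightarrow> length (up_bits b (t @ [(a, up, x)])) \<le> length (W b m)"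
    using * by blast+
qed

abbreviation "rn \<equiv> run prot \<alpha> v r"

text \<open>The transcript bound holds for every admissible \<open>m\<close> at once, although the
  protocol does not know a good one: \<open>m = K\<close> always applies, and the analysis supplies
  a cheaper choice.\<close>

lemma run_invariant:
  assumes m: "m \<le> K" "m = K \<or> T \<le> card {i \<in> (\<Union>a\<in>{1..<\<alpha>}. v a). g (r 0) i < m}"
  shows "faithful (rn k) \<and> (\<forall>b\<in>{1..<\<alpha>}. length (up_bits b (rn k)) \<le> length (W b m))"
proof (induction k)
  case 0
  show ?case by (simp add: faithful_def)
next
  case (Suc k)
  show ?case
  proof (cases "sched (rn k)")
    case None
    then show ?thesis using Suc by simp
  next
    case (Some p)
    obtain a up where p: "p = (a, up)" by (cases p)
    have f: "faithful (rn k)" and b: "\<And>b. b \<in> {1..<\<alpha>} \<Longrightarrow> length (up_bits b (rn k)) \<le> length (W b m)"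
      using Suc by blast+
    have s: "sched (rn k) = Some (a, up)" using Some p by simp
    note step = run_step[OF f s m b]
    have "rn (Suc k) = rn k @ [(a, up, if up then msg a (v a) (r a) (local_view a (rn k)) else msg 0 (v 0) (r 0) (rn k))]"
      using s step(1) by (simp add: Let_def)
    then show ?thesis using step(2,3) by simp
  qed
qed

lemma run_invariant_K:
  "faithful (rn k)" "b \<in> {1..<\<alpha>} \<Longrightarrow> length (up_bits b (rn k)) \<le> length (W b K)"
  using run_invariant[of K k] by auto

text \<open>A run stalls only because the schedule returns \<open>None\<close>, never because of an
  illegal channel; hence halting can be read off the schedule.\<close>

lemma run_Suc:
  "(sched (rn k) = None \<and> rn (Suc k) = rn k) \<or>
   (sched (rn k) \<noteq> None \<and> length (rn (Suc k)) = Suc (length (rn k)))"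
proof (cases "sched (rn k)")
  case (Some p)
  obtain a up where p: "p = (a, up)" by (cases p)
  have s: "sched (rn k) = Some (a, up)" using Some p by simp
  have "a \<in> {1..<\<alpha>}"
    by (rule run_step(1)[OF run_invariant_K(1) s order.refl disjI1[OF refl] run_invariant_K(2)])
  then show ?thesis using Some p by (simp add: Let_def)
qed simp

lemma length_run_le:
  assumes m: "m \<le> K" "m = K \<or> T \<le> card {i \<in> (\<Union>a\<in>{1..<\<alpha>}. v a). g (r 0) i < m}"
  shows "length (rn k) \<le> (\<Sum>a\<in>{1..<\<alpha>}. D + (m + (w + 1) * card {i \<in> v a. g (r 0) i < m}))"
proof -
  note I = run_invariant[OF m, of k]
  have "length (rn k) = (\<Sum>a\<in>{1..<\<alpha>}. length (down_bits a (rn k)) + length (up_bits a (rn k)))"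
    using I by (simp add: faithful_def)
  also have "\<dots> \<le> (\<Sum>a\<in>{1..<\<alpha>}. D + length (W a m))"
  proof (intro sum_mono add_mono)
    fix a assume a: "a \<in> {1..<\<alpha>}"
    have "down_bits a (rn k) = take (length (down_bits a (rn k))) (nat_bits D (r 0))"
      using I a by (simp add: faithful_def)
    then show "length (down_bits a (rn k)) \<le> D"
      by (metis length_nat_bits length_take min.cobounded1)
    show "length (up_bits a (rn k)) \<le> length (W a m)" using I a by blast
  qed
  also have "\<dots> = (\<Sum>a\<in>{1..<\<alpha>}. D + (m + (w + 1) * card {i \<in> v a. g (r 0) i < m}))"
    by (intro sum.cong refl) (simp add: W_def length_level_stream fin)
  finally show ?thesis .
qed

lemma length_run_le_L: "length (rn k) \<le> L"
proof (induction k)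
  case (Suc k)
  show ?case
  proof (cases "sched (rn k)")
    case None then show ?thesis using Suc by simp
  next
    case (Some p)
    then have "length (rn k) < L" by (auto simp: sched_def split: if_splits)
    then show ?thesis using run_Suc[of k] by auto
  qed
qed simp

text \<open>Each step before stopping adds a bit, and the budget caps the length. The second bound,
  the cost of sending everything, is the one used for small unions.\<close>

lemma prot_halts:
  obtains t where "halts_with prot \<alpha> v r t" "length t \<le> L"
    "length t \<le> (\<Sum>a\<in>{1..<\<alpha>}. D + (K + (w + 1) * card (v a)))"
proof -
  have "\<exists>k. sched (rn k) = None"
  proof (rule ccontr)
    assume "\<not> ?thesis"
    then have "length (rn (Suc k)) = Suc (length (rn k))" for k using run_Suc[of k] by blast
    then have "length (rn k) = k" for k by (induction k) simp_all
    from this[of "Suc L"] length_run_le_L[of "Suc L"] show False by simp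
  qed
  then obtain k where "sched (rn k) = None" ..
  then have h: "halts_with prot \<alpha> v r (rn k)" unfolding halts_with_def using run_Suc[of k] by auto
  have "length (rn k) \<le> (\<Sum>a\<in>{1..<\<alpha>}. D + (K + (w + 1) * card {i \<in> v a. g (r 0) i < K}))"
    by (rule length_run_le) auto
  also have "\<dots> \<le> (\<Sum>a\<in>{1..<\<alpha>}. D + (K + (w + 1) * card (v a)))"
    using fin by (intro sum_mono add_mono mult_le_mono card_mono) auto
  finally show ?thesis using that h length_run_le_L by blast
qed

text \<open>If reading \<open>m\<close> levels fits strictly into the budget, the run stops because
  of \<open>enough\<close> and not for lack of bits. The number \<open>m'\<close> of levels that
  triggers this may differ from \<open>m\<close>.\<close>

lemma prot_output:
  assumes h: "halts_with prot \<alpha> v r t" and "\<alpha> \<ge> 1"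
    and m: "m \<le> K" "m = K \<or> T \<le> card {i \<in> (\<Union>a\<in>{1..<\<alpha>}. v a). g (r 0) i < m}"
    and L: "(\<Sum>a\<in>{1..<\<alpha>}. D + (m + (w + 1) * card {i \<in> v a. g (r 0) i < m})) < L"
  obtains S m' where "outp (v 0) (r 0) t = est (r 0) S" "S \<subseteq> (\<Union>a<\<alpha>. v a)"
    "{i \<in> (\<Union>a<\<alpha>. v a). g (r 0) i < m'} \<subseteq> S"
    "m' = K \<or> T \<le> card {i \<in> (\<Union>a<\<alpha>. v a). g (r 0) i < m'}"
proof -
  obtain k where t: "t = rn k" "rn (Suc k) = rn k" using h by (auto simp: halts_with_def)
  have "length t < L" using le_less_trans[OF length_run_le[OF m, of k] L] t(1) by simp
  moreover have "sched t = None" using run_Suc[of k] t by auto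
  ultimately obtain m' where m': "enough t m'" by (auto simp: sched_def split: if_splits)
  have f: "faithful t" using run_invariant_K(1)[of k] t by simp
  define S where "S = v 0 \<union> {i. \<exists>a\<in>{1..<\<alpha>}. \<exists>d. (d, i) \<in> items t a}"
  have split: "(\<Union>a<\<alpha>. v a) = v 0 \<union> (\<Union>a\<in>{1..<\<alpha>}. v a)"
  proof -
    have "{..<\<alpha>} = insert 0 {1..<\<alpha>}" using \<open>\<alpha> \<ge> 1\<close> by auto
    then show ?thesis by simp
  qed
  have mK: "m' \<le> K" and all: "\<forall>a\<in>{1..<\<alpha>}. m' \<le> levels_done t a" using m' by (auto simp: enough_def)
  show ?thesis
  proof (rule that)
    show "outp (v 0) (r 0) t = est (r 0) S" by (simp add: outp_def S_def)
    show "S \<subseteq> (\<Union>a<\<alpha>. v a)"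
      unfolding S_def split using items_sound(1)[OF f] by blast
    show "{i \<in> (\<Union>a<\<alpha>. v a). g (r 0) i < m'} \<subseteq> S"
      unfolding S_def split using items_complete[OF f _ mK] all by blast
    have "m' = K \<or> T \<le> card {i \<in> (\<Union>a\<in>{1..<\<alpha>}. v a). g (r 0) i < m'}"
      using m' unfolding enough_def tagged_items_eq[OF f mK all] by blast
    moreover have "card {i \<in> (\<Union>a\<in>{1..<\<alpha>}. v a). g (r 0) i < m'} \<le> card {i \<in> (\<Union>a<\<alpha>. v a). g (r 0) i < m'}"
      by (intro card_mono) (auto simp: fin)
    ultimately show "m' = K \<or> T \<le> card {i \<in> (\<Union>a<\<alpha>. v a). g (r 0) i < m'}" by linarith
  qed
qed

end

end

section \<open>Load, accuracy and cost\<close>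

text \<open>Let \<open>m i\<close> be the number of holders of item \<open>i\<close>. Counting pairs
  of holders gives \<open>sum (m i)^2 <= sum (m i) + 2 * C\<close>, hence
  \<open>sum (m i - 1)^2 <= 2 * C\<close>, and Cauchy--Schwarz bounds the excess
  \<open>sum (m i - 1)\<close>.\<close>

lemma sum_card_le_union_collisions:
  fixes v :: "nat \<Rightarrow> nat set"
  assumes A: "finite A" and fin: "\<And>a. a \<in> A \<Longrightarrow> finite (v a)"
  defines "F \<equiv> card (\<Union>a\<in>A. v a)"
    and "C \<equiv> card {(a, b, i). a \<in> A \<and> b \<in> A \<and> a < b \<and> i \<in> v a \<and> i \<in> v b}"
  shows "real (\<Sum>a\<in>A. card (v a)) \<le> real F + sqrt (2 * real F * real C)"
proof -
  let ?U = "\<Union>a\<in>A. v a"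
  define m where "m i = card {a \<in> A. i \<in> v a}" for i
  have finU: "finite ?U" using A fin by blast
  have m_pos: "m i \<ge> 1" if "i \<in> ?U" for i
  proof -
    have "{a \<in> A. i \<in> v a} \<noteq> {}" using that by blast
    then show ?thesis using A by (simp add: m_def Suc_leI card_gt_0_iff)
  qed
  have "(\<Sum>a\<in>A. card (v a)) = (\<Sum>a\<in>A. \<Sum>i\<in>?U. if i \<in> v a then 1 else 0)"
  proof (rule sum.cong[OF refl])
    fix a assume "a \<in> A"
    then have "?U \<inter> v a = v a" by blast
    then show "card (v a) = (\<Sum>i\<in>?U. if i \<in> v a then 1 else 0)"
      using finU by (simp add: sum.If_cases)
  qed
  also have "\<dots> = (\<Sum>i\<in>?U. \<Sum>a\<in>A. if i \<in> v a then 1 else 0)" by (rule sum.swap)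
  also have "\<dots> = (\<Sum>i\<in>?U. m i)"
    using A by (intro sum.cong refl) (simp add: sum.If_cases m_def Int_def)
  finally have M: "(\<Sum>a\<in>A. card (v a)) = (\<Sum>i\<in>?U. m i)" .
  \<comment> \<open>Ordered pairs of holders of an item are diagonal or one of the two orientations
    of a collision.\<close>
  let ?P = "SIGMA i:?U. {a \<in> A. i \<in> v a} \<times> {b \<in> A. i \<in> v b}"
  let ?D = "SIGMA i:?U. (\<lambda>a. (a, a)) ` {a \<in> A. i \<in> v a}"
  let ?C = "{(a, b, i). a \<in> A \<and> b \<in> A \<and> a < b \<and> i \<in> v a \<and> i \<in> v b}"
  let ?f = "\<lambda>(a, b, i). (i, (a, b))" and ?g = "\<lambda>(a, b, i). (i, (b, a))"
  have finC: "finite ?C"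
    by (rule finite_subset[of _ "A \<times> A \<times> ?U"]) (use A finU in auto)
  have cover: "?P \<subseteq> ?D \<union> (?f ` ?C \<union> ?g ` ?C)"
  proof
    fix z assume "z \<in> ?P"
    then obtain i a b where z: "z = (i, (a, b))" "i \<in> ?U" "a \<in> A" "b \<in> A" "i \<in> v a" "i \<in> v b" by auto
    consider "a = b" | "a < b" | "b < a" by linarith
    then show "z \<in> ?D \<union> (?f ` ?C \<union> ?g ` ?C)"
    proof cases
      case 1 then show ?thesis using z by auto
    next
      case 2
      then have "(a, b, i) \<in> ?C" using z by simp
      from imageI[OF this, of ?f] show ?thesis unfolding z(1) by simp
    next
      case 3
      then have "(b, a, i) \<in> ?C" using z by simp
      from imageI[OF this, of ?g] show ?thesis unfolding z(1) by simp
    qed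
  qed
  have "(\<Sum>i\<in>?U. m i * m i) = card ?P"
    using finU A by (subst card_SigmaI) (auto simp: card_cartesian_product m_def)
  also have "\<dots> \<le> card (?D \<union> (?f ` ?C \<union> ?g ` ?C))"
    using finU A finC by (intro card_mono[OF _ cover]) auto
  also have "\<dots> \<le> card ?D + (card (?f ` ?C) + card (?g ` ?C))"
    by (rule order.trans[OF card_Un_le add_left_mono[OF card_Un_le]])
  also have "\<dots> \<le> card ?D + (C + C)"
    unfolding C_def by (intro add_mono order.refl card_image_le[OF finC])
  also have "card ?D = (\<Sum>i\<in>?U. m i)"
    using finU A by (subst card_SigmaI) (auto simp: card_image inj_on_def m_def)
  finally have sq: "(\<Sum>i\<in>?U. m i * m i) \<le> (\<Sum>i\<in>?U. m i) + 2 * C" by simp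
  \<comment> \<open>Since \<open>m i >= 1\<close>,
    \<open>(m i - 1)^2 <= m i * (m i - 1)\<close>.\<close>
  have "(\<Sum>i\<in>?U. (real (m i) - 1)\<^sup>2) \<le> (\<Sum>i\<in>?U. real (m i) * real (m i) - real (m i))"
    using m_pos by (intro sum_mono) (auto simp: power2_eq_square algebra_simps)
  also have "\<dots> = real (\<Sum>i\<in>?U. m i * m i) - real (\<Sum>i\<in>?U. m i)"
    by (simp add: sum_subtractf)
  also have "\<dots> \<le> 2 * C" using sq by linarith
  finally have var: "(\<Sum>i\<in>?U. (real (m i) - 1)\<^sup>2) \<le> 2 * C" .
  have "(\<Sum>i\<in>?U. real (m i) - 1)\<^sup>2 \<le> (\<Sum>i\<in>?U. (real (m i) - 1)\<^sup>2) * F"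
    unfolding F_def by (rule sum_squared_le_sum_of_squares)
  also have "\<dots> \<le> (2 * C) * real F" by (rule mult_right_mono[OF var]) simp
  finally have "(\<Sum>i\<in>?U. real (m i) - 1) \<le> sqrt (2 * real F * real C)"
    by (intro real_le_rsqrt) (simp add: mult_ac)
  moreover have "(\<Sum>i\<in>?U. real (m i) - 1) = real (\<Sum>i\<in>?U. m i) - F"
    by (simp add: sum_subtractf F_def)
  ultimately show ?thesis unfolding M by linarith
qed

section \<open>The bottom-T estimator\<close>

definition threshold :: "nat \<Rightarrow> nat \<Rightarrow> nat \<Rightarrow> nat set \<Rightarrow> nat" where
  "threshold p T s S = (LEAST x. T \<le> card {i \<in> S. affine_hash p s i < x})"

text \<open>\<open>threshold\<close> is one more than the \<open>T\<close>-th smallest hash value.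
  For \<open>F\<close> items it lies near \<open>T * p / F\<close>, and solving for \<open>F\<close>
  gives the estimate; fewer than \<open>T\<close> items are counted exactly.\<close>

definition bottom_estimate :: "nat \<Rightarrow> nat \<Rightarrow> nat \<Rightarrow> nat set \<Rightarrow> real" where
  "bottom_estimate p T s S =
    (if card S < T then real (card S) else real T * real p / real (threshold p T s S))"

definition hash_level :: "nat \<Rightarrow> nat \<Rightarrow> nat \<Rightarrow> nat" where
  "hash_level p s i = (LEAST d. affine_hash p s i < 2 ^ d)"

text \<open>The first \<open>j + 1\<close> levels are the sample of rate about
  \<open>2^j / p\<close>, so each further level doubles the rate.\<close>

lemma hash_level_less_Suc: "hash_level p s i < Suc j \<longleftrightarrow> affine_hash p s i < 2 ^ j"
proof
  have "affine_hash p s i < 2 ^ affine_hash p s i" by simp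
  then have "affine_hash p s i < 2 ^ hash_level p s i" unfolding hash_level_def by (rule LeastI)
  moreover assume "hash_level p s i < Suc j"
  then have "(2::nat) ^ hash_level p s i \<le> 2 ^ j" by (intro power_increasing) auto
  ultimately show "affine_hash p s i < 2 ^ j" by linarith
next
  assume "affine_hash p s i < 2 ^ j"
  then show "hash_level p s i < Suc j" unfolding hash_level_def by (simp add: Least_le less_Suc_eq_le)
qed

text \<open>The estimate depends only on the \<open>T\<close> smallest hash values, and these belong
  to the completed levels if those contain \<open>T\<close> items. If all levels are complete,
  \<open>S\<close> is the whole of \<open>U\<close>.\<close>

lemma bottom_estimate_cong:
  assumes U: "finite U" "S \<subseteq> U" and p: "0 < p" "p \<le> 2 ^ k" and T: "T \<ge> 1"
    and sub: "{i \<in> U. hash_level p s i < m} \<subseteq> S"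
    and m: "m = Suc k \<or> T \<le> card {i \<in> U. hash_level p s i < m}"
  shows "bottom_estimate p T s S = bottom_estimate p T s U"
proof (cases "m = Suc k")
  case True
  have "affine_hash p s i < 2 ^ k" for i
    using affine_hash_less[OF p(1)] p(2) by (rule less_le_trans)
  then have "S = U" using sub U(2) True by (auto simp: hash_level_less_Suc)
  then show ?thesis by simp
next
  case False
  then have card: "T \<le> card {i \<in> U. hash_level p s i < m}" using m by blast
  then obtain j where j: "m = Suc j" using T by (cases m) auto
  let ?Q = "{i \<in> U. affine_hash p s i < 2 ^ j}"
  have Q: "?Q \<subseteq> S" "T \<le> card ?Q" using sub card by (simp_all add: j hash_level_less_Suc)
  have finS: "finite S" using U by (rule rev_finite_subset)
  have "T \<le> card S" "T \<le> card U"
    using Q(2) card_mono[OF finS Q(1)] card_mono[OF U] by linarith+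
  \<comment> \<open>Up to \<open>2^j\<close> both sets have the same items, and beyond it both
    counts are at least \<open>T\<close>, so the two thresholds agree.\<close>
  moreover have "T \<le> card {i \<in> S. affine_hash p s i < x} \<longleftrightarrow> T \<le> card {i \<in> U. affine_hash p s i < x}" for x
  proof (cases "x \<le> 2 ^ j")
    case True
    then have "{i \<in> S. affine_hash p s i < x} = {i \<in> U. affine_hash p s i < x}"
      using Q(1) U(2) by auto
    then show ?thesis by simp
  next
    case False
    then have "?Q \<subseteq> {i \<in> S. affine_hash p s i < x}" "?Q \<subseteq> {i \<in> U. affine_hash p s i < x}"
      using Q(1) by auto
    then have "card ?Q \<le> card {i \<in> S. affine_hash p s i < x}" "card ?Q \<le> card {i \<in> U. affine_hash p s i < x}"
      using finS U(1) by (auto intro: card_mono)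
    then show ?thesis using Q(2) by linarith
  qed
  ultimately show ?thesis by (simp add: bottom_estimate_def threshold_def)
qed

lemma threshold_le_iff:
  assumes "finite U"  "T \<le> card {i \<in> U. affine_hash p s i < y}"
  shows "threshold p T s U \<le> x \<longleftrightarrow> T \<le> card {i \<in> U. affine_hash p s i < x}"
proof
  assume le: "threshold p T s U \<le> x"
  have "T \<le> card {i \<in> U. affine_hash p s i < threshold p T s U}"
    unfolding threshold_def using assms(2) by (rule LeastI)
  also have "\<dots> \<le> card {i \<in> U. affine_hash p s i < x}"
    using le assms(1) by (intro card_mono) auto
  finally show "T \<le> card {i \<in> U. affine_hash p s i < x}" .
next
  assume "T \<le> card {i \<in> U. affine_hash p s i < x}"
  then show "threshold p T s U \<le> x" unfolding threshold_def by (rule Least_le)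
qed

text \<open>An overestimate forces at least \<open>T\<close> hash values below a point where fewer than
  \<open>T / (1 + \<epsilon>)\<close> are expected.\<close>

lemma card_overestimate_le:
  fixes \<epsilon> :: real
  assumes p: "prime p" and U: "U \<subseteq> {..<p}" and \<epsilon>: "0 < \<epsilon>" "\<epsilon> < 1" and T: "1 \<le> T" "T \<le> card U"
  shows "real (card {s \<in> {..<p * p}. (1 + \<epsilon>) * card U < bottom_estimate p T s U})
    \<le> real (p * p) * (2 / (T * \<epsilon>\<^sup>2))"
proof -
  have p0: "p > 0" using p by (rule prime_gt_0_nat)
  have fin: "finite U" using U by (rule finite_subset) simp
  define F where "F = real (card U)"
  have F: "F \<ge> T" "F > 0" "real T > 0" using T by (auto simp: F_def)
  define y where "y = T * p / ((1 + \<epsilon>) * F)"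
  have "y > 0" using F p0 \<epsilon> by (simp add: y_def)
  \<comment> \<open>The largest integer strictly below \<open>y\<close>: an overestimate puts the
    threshold strictly below \<open>y\<close>, hence at most at \<open>x\<close>.\<close>
  define x where "x = nat (\<lceil>y\<rceil> - 1)"
  have "1 \<le> \<lceil>y\<rceil>" using \<open>y > 0\<close> by (simp add: one_le_ceiling)
  then have rx: "real x = of_int \<lceil>y\<rceil> - 1" unfolding x_def by simp
  have x: "real x < y" using rx ceiling_correct[of y] by linarith
  have x_max: "z \<le> x" if "real z < y" for z :: nat
  proof -
    have "of_int (int z) < y" using that by simp
    then have "int z < \<lceil>y\<rceil>" by (simp only: less_ceiling_iff)
    then show ?thesis unfolding x_def by linarith
  qed
  have "y \<le> p"
  proof -
    have "real T * p \<le> ((1 + \<epsilon>) * F) * p"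
      using F \<epsilon> by (intro mult_right_mono) (auto intro: order.trans[of _ "1 * F"] mult_right_mono)
    then show ?thesis using F \<epsilon> by (simp add: y_def divide_le_eq mult_ac)
  qed
  then have xp: "x \<le> p" using x by linarith
  define \<mu> where "\<mu> = real (card U) * x / p"
  \<comment> \<open>This is \<open>T - T / (1 + \<epsilon>)\<close>, the gap between the count
    observed and the bound on its mean.\<close>
  define \<delta> where "\<delta> = T * \<epsilon> / (1 + \<epsilon>)"
  have \<delta>: "\<delta> > 0" using F \<epsilon> by (simp add: \<delta>_def)
  have \<mu>: "\<mu> \<le> T / (1 + \<epsilon>)"
  proof -
    have "\<mu> \<le> F * y / p" unfolding \<mu>_def F_def[symmetric] using x F p0
      by (intro divide_right_mono mult_left_mono) auto
    also have "\<dots> = T / (1 + \<epsilon>)" using F \<epsilon> p0 by (simp add: y_def)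
    finally show ?thesis .
  qed
  have "{s \<in> {..<p * p}. (1 + \<epsilon>) * card U < bottom_estimate p T s U}
     \<subseteq> {s \<in> {..<p * p}. \<bar>real (card {i \<in> U. affine_hash p s i < x}) - \<mu>\<bar> \<ge> \<delta>}"
  proof safe
    fix s assume over: "(1 + \<epsilon>) * card U < bottom_estimate p T s U"
    let ?t = "threshold p T s U"
    have est: "(1 + \<epsilon>) * F < T * p / ?t" using over T by (simp add: bottom_estimate_def F_def)
    moreover have F1: "0 < (1 + \<epsilon>) * F" using F \<epsilon> by simp
    ultimately have t0: "real ?t > 0" by (cases "?t = 0") auto
    have "(1 + \<epsilon>) * F * real ?t < T * p" using est t0 by (simp only: pos_less_divide_eq)
    then have "real ?t < y" unfolding y_def pos_less_divide_eq[OF F1] by (simp only: mult.commute)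
    then have "?t \<le> x" by (rule x_max)
    moreover have "T \<le> card {i \<in> U. affine_hash p s i < p}"
      using T affine_hash_less[OF p0] by simp
    ultimately have "T \<le> card {i \<in> U. affine_hash p s i < x}"
      using threshold_le_iff[OF fin] by blast
    moreover have "T - T / (1 + \<epsilon>) = \<delta>" using \<epsilon> by (simp add: \<delta>_def field_simps)
    ultimately show "\<bar>real (card {i \<in> U. affine_hash p s i < x}) - \<mu>\<bar> \<ge> \<delta>"
      using \<mu> by linarith
  qed
  then have "card {s \<in> {..<p * p}. (1 + \<epsilon>) * card U < bottom_estimate p T s U}
     \<le> card {s \<in> {..<p * p}. \<bar>real (card {i \<in> U. affine_hash p s i < x}) - \<mu>\<bar> \<ge> \<delta>}"
    by (intro card_mono) auto
  then have "real (card {s \<in> {..<p * p}. (1 + \<epsilon>) * card U < bottom_estimate p T s U})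
     \<le> real (card {s \<in> {..<p * p}. \<bar>real (card {i \<in> U. affine_hash p s i < x}) - \<mu>\<bar> \<ge> \<delta>})"
    by simp
  also have "\<dots> \<le> real (p * p) * (\<mu> / \<delta>\<^sup>2)"
    unfolding \<mu>_def by (rule card_sample_deviation_le[OF p U xp \<delta>])
  also have "\<dots> \<le> real (p * p) * (2 / (T * \<epsilon>\<^sup>2))"
  proof (intro mult_left_mono)
    have "\<mu> / \<delta>\<^sup>2 \<le> (T / (1 + \<epsilon>)) / \<delta>\<^sup>2" using \<mu> by (intro divide_right_mono) auto
    also have "\<dots> = (1 + \<epsilon>) / (T * \<epsilon>\<^sup>2)"
    proof -
      have "a / e / (a * b / e)\<^sup>2 = e / (a * b\<^sup>2)" if "a > 0" "b > 0" "e > 0" for a b e :: real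
        using that by (simp add: field_simps power2_eq_square)
      then show ?thesis unfolding \<delta>_def using \<epsilon> F by simp
    qed
    also have "\<dots> \<le> 2 / (T * \<epsilon>\<^sup>2)" using \<epsilon> F by (intro divide_right_mono) auto
    finally show "\<mu> / \<delta>\<^sup>2 \<le> 2 / (T * \<epsilon>\<^sup>2)" .
  qed simp
  finally show ?thesis .
qed

text \<open>An underestimate puts the threshold above \<open>y\<close>, so fewer than
  \<open>T\<close> hash values lie below the integer part of \<open>y\<close>, although about
  \<open>T / (1 - \<epsilon>)\<close> are expected there.\<close>

lemma card_underestimate_le:
  fixes \<epsilon> :: real
  assumes p: "prime p" and U: "U \<subseteq> {..<p}" and \<epsilon>: "0 < \<epsilon>" "\<epsilon> < 1" and T: "2 \<le> T * \<epsilon>" "T \<le> card U"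
  shows "real (card {s \<in> {..<p * p}. bottom_estimate p T s U < (1 - \<epsilon>) * card U})
    \<le> real (p * p) * (4 / (T * \<epsilon>\<^sup>2))"
proof -
  have p0: "p > 0" using p by (rule prime_gt_0_nat)
  have fin: "finite U" using U by (rule finite_subset) simp
  define F where "F = real (card U)"
  have T0: "T > 0" using T(1) by (cases "T = 0") auto
  have F: "F \<ge> T" "F > 0" "real T > 0" using T T0 by (auto simp: F_def)
  have Fp: "F \<le> p" using card_mono[OF _ U] by (simp add: F_def)
  define y where "y = T * p / ((1 - \<epsilon>) * F)"
  have "y > 0" using F p0 \<epsilon> by (simp add: y_def)
  define x where "x = nat \<lfloor>y\<rfloor>"
  have rx: "real x = of_int \<lfloor>y\<rfloor>" unfolding x_def using \<open>y > 0\<close> by simp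
  have x: "real x \<le> y" "y - 1 \<le> real x" using rx floor_correct[of y] by linarith+
  define \<mu> where "\<mu> = real (card U) * x / p"
  \<comment> \<open>Half of the gap \<open>T / (1 - \<epsilon>) - T\<close>. The other half, at
    least 1 by \<open>2 <= T * \<epsilon>\<close>, absorbs the loss of at most
    \<open>F / p <= 1\<close> in the mean from rounding \<open>y\<close> down.\<close>
  define \<delta> where "\<delta> = T * \<epsilon> / (2 * (1 - \<epsilon>))"
  have \<delta>: "\<delta> > 0" using F \<epsilon> by (simp add: \<delta>_def)
  have Fy: "F * y / p = T / (1 - \<epsilon>)" using F \<epsilon> p0 by (simp add: y_def)
  have \<mu>_le: "\<mu> \<le> T / (1 - \<epsilon>)"
  proof -
    have "\<mu> \<le> F * y / p" unfolding \<mu>_def F_def[symmetric] using x F p0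
      by (intro divide_right_mono mult_left_mono) auto
    then show ?thesis using Fy by simp
  qed
  have \<mu>_ge: "T + \<delta> \<le> \<mu>"
  proof -
    have "1 \<le> \<delta>" using T(1) \<epsilon> unfolding \<delta>_def by (simp add: le_divide_eq)
    have "T / (1 - \<epsilon>) - F / p = F * (y - 1) / p" using Fy by (simp add: right_diff_distrib diff_divide_distrib)
    also have "\<dots> \<le> \<mu>" unfolding \<mu>_def F_def[symmetric] using x F p0
      by (intro divide_right_mono mult_left_mono) auto
    finally have "T / (1 - \<epsilon>) - F / p \<le> \<mu>" .
    moreover have "F / p \<le> 1" using Fp p0 by simp
    moreover have "T / (1 - \<epsilon>) = T + 2 * \<delta>" using \<epsilon> by (simp add: \<delta>_def field_simps)
    ultimately show ?thesis using \<open>1 \<le> \<delta>\<close> by linarith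
  qed
  let ?Bad = "{s \<in> {..<p * p}. bottom_estimate p T s U < (1 - \<epsilon>) * card U}"
  have bad: "x < p \<and> card {i \<in> U. affine_hash p s i < x} < T" if "s \<in> ?Bad" for s
  proof -
    let ?t = "threshold p T s U"
    have full: "T \<le> card {i \<in> U. affine_hash p s i < p}"
      using T affine_hash_less[OF p0] by simp
    have "?t > 0"
      using threshold_le_iff[OF fin full, of 0] T0 by auto
    moreover have est: "T * p / ?t < (1 - \<epsilon>) * F"
      using that T by (simp add: bottom_estimate_def F_def)
    ultimately have "y < real ?t" using F \<epsilon> unfolding y_def by (simp add: field_simps)
    then have "x < ?t" using x by linarith
    moreover have "?t \<le> p" using threshold_le_iff[OF fin full] full by blast
    moreover have "\<not> T \<le> card {i \<in> U. affine_hash p s i < x}"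
      using \<open>x < ?t\<close> threshold_le_iff[OF fin full, of x] by linarith
    ultimately show ?thesis by linarith
  qed
  \<comment> \<open>Chebyshev's bound needs \<open>x <= p\<close>. Thresholds never exceed
    \<open>p\<close>, so this holds as soon as some seed is bad.\<close>
  show ?thesis
  proof (cases "?Bad = {}")
    case True
    then show ?thesis by (simp only: card.empty) simp
  next
    case False
    then have xp: "x \<le> p" using bad by fastforce
    have "?Bad \<subseteq> {s \<in> {..<p * p}. \<bar>real (card {i \<in> U. affine_hash p s i < x}) - \<mu>\<bar> \<ge> \<delta>}"
    proof
      fix s assume s: "s \<in> ?Bad"
      have "real (card {i \<in> U. affine_hash p s i < x}) < T" using bad[OF s] by simp
      then have "\<bar>real (card {i \<in> U. affine_hash p s i < x}) - \<mu>\<bar> \<ge> \<delta>" using \<mu>_ge by linarith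
      then show "s \<in> {s \<in> {..<p * p}. \<bar>real (card {i \<in> U. affine_hash p s i < x}) - \<mu>\<bar> \<ge> \<delta>}"
        using s by blast
    qed
    then have "card ?Bad \<le> card {s \<in> {..<p * p}. \<bar>real (card {i \<in> U. affine_hash p s i < x}) - \<mu>\<bar> \<ge> \<delta>}"
      by (intro card_mono) auto
    then have "real (card ?Bad) \<le> real (card {s \<in> {..<p * p}. \<bar>real (card {i \<in> U. affine_hash p s i < x}) - \<mu>\<bar> \<ge> \<delta>})"
      by simp
    also have "\<dots> \<le> real (p * p) * (\<mu> / \<delta>\<^sup>2)"
      unfolding \<mu>_def by (rule card_sample_deviation_le[OF p U xp \<delta>])
    also have "\<dots> \<le> real (p * p) * (4 / (T * \<epsilon>\<^sup>2))"
    proof (intro mult_left_mono)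
      have "\<mu> / \<delta>\<^sup>2 \<le> (T / (1 - \<epsilon>)) / \<delta>\<^sup>2" using \<mu>_le by (intro divide_right_mono) auto
      also have "\<dots> = 4 * (1 - \<epsilon>) / (T * \<epsilon>\<^sup>2)"
        using \<epsilon> F by (simp add: \<delta>_def field_simps power2_eq_square)
      also have "\<dots> \<le> 4 / (T * \<epsilon>\<^sup>2)" using \<epsilon> F by (intro divide_right_mono) auto
      finally show "\<mu> / \<delta>\<^sup>2 \<le> 4 / (T * \<epsilon>\<^sup>2)" .
    qed simp
    finally show ?thesis .
  qed
qed

lemma card_bad_estimate_le:
  fixes \<epsilon> :: real
  assumes p: "prime p" and U: "U \<subseteq> {..<p}" and \<epsilon>: "0 < \<epsilon>" "\<epsilon> < 1" and T: "2 \<le> T * \<epsilon>"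
  shows "real (card {s \<in> {..<p * p}. \<not> rel_approx \<epsilon> (card U) (bottom_estimate p T s U)})
    \<le> real (p * p) * (6 / (T * \<epsilon>\<^sup>2))"
proof (cases "card U < T")
  case True
  have "rel_approx \<epsilon> (card U) (bottom_estimate p T s U)" for s
    using True \<epsilon> mult_right_mono[of "1 - \<epsilon>" 1 "real (card U)"] mult_right_mono[of 1 "1 + \<epsilon>" "real (card U)"]
    by (simp add: bottom_estimate_def rel_approx_def)
  then show ?thesis by simp
next
  case False
  let ?O = "{s \<in> {..<p * p}. (1 + \<epsilon>) * card U < bottom_estimate p T s U}"
  let ?D = "{s \<in> {..<p * p}. bottom_estimate p T s U < (1 - \<epsilon>) * card U}"
  have T1: "1 \<le> T" using T by (cases "T = 0") auto
  have "card {s \<in> {..<p * p}. \<not> rel_approx \<epsilon> (card U) (bottom_estimate p T s U)} \<le> card (?O \<union> ?D)"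
    by (intro card_mono) (auto simp: rel_approx_def)
  also have "\<dots> \<le> card ?O + card ?D" by (rule card_Un_le)
  finally have "real (card {s \<in> {..<p * p}. \<not> rel_approx \<epsilon> (card U) (bottom_estimate p T s U)})
     \<le> real (card ?O) + real (card ?D)" by linarith
  also have "\<dots> \<le> real (p * p) * (2 / (T * \<epsilon>\<^sup>2)) + real (p * p) * (4 / (T * \<epsilon>\<^sup>2))"
    using card_overestimate_le[OF p U \<epsilon> T1] card_underestimate_le[OF p U \<epsilon> T] False by (intro add_mono) auto
  also have "\<dots> = real (p * p) * (6 / (T * \<epsilon>\<^sup>2))"
    by (simp add: distrib_left[symmetric] add_divide_distrib[symmetric])
  finally show ?thesis .
qed

text \<open>If \<open>F >= 2 * T\<close>, take the least \<open>j\<close> for which the sample has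
  mean at least \<open>2 * T\<close>; by minimality the mean is at most \<open>4 * T\<close>.
  Chebyshev yields \<open>T\<close> distinct items up to failure \<open>2 / T\<close>. The mean load
  is at most \<open>4 * T * (1 + sqrt q) = B / 24\<close>, so Markov fails with probability at most
  \<open>1 / 24\<close>. For smaller \<open>F\<close> all levels fit below \<open>B\<close>.\<close>

lemma exists_cheap_level:
  fixes v :: "nat \<Rightarrow> nat set" and q :: real
  assumes p: "prime p" "p \<le> 2 ^ k" and A: "finite A" and v: "\<And>a. a \<in> A \<Longrightarrow> v a \<subseteq> {..<p}"
    and T: "1 \<le> T" and q: "q \<ge> 0"
  defines "U \<equiv> \<Union>a\<in>A. v a"
  defines "B \<equiv> 96 * T * (1 + sqrt q)"
  assumes load: "real (\<Sum>a\<in>A. card (v a)) \<le> real (card U) + sqrt (2 * real (card U) * (q * real T))"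
  shows "\<exists>j\<le>k. real (card {s \<in> {..<p * p}.
      \<not> ((j = k \<or> T \<le> card {i \<in> U. affine_hash p s i < 2 ^ j}) \<and>
         real (\<Sum>a\<in>A. card {i \<in> v a. affine_hash p s i < 2 ^ j}) < B)})
    \<le> real (p * p) * (2 / T + 1 / 24)"
proof -
  have p0: "p > 0" using p(1) by (rule prime_gt_0_nat)
  have T0: "real T > 0" using T by simp
  have U: "U \<subseteq> {..<p}" using v by (auto simp: U_def)
  have finv: "finite (v a)" if "a \<in> A" for a using v[OF that] by (rule finite_subset) simp
  define F where "F = real (card U)"
  define M where "M = real (\<Sum>a\<in>A. card (v a))"
  have B0: "B > 0" using T0 q by (simp add: B_def add_pos_nonneg)
  show ?thesis
  proof (cases "F < 2 * T")
    case True
    have "M \<le> F + sqrt (2 * F * (q * T))" using load by (simp add: M_def F_def)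
    also have "\<dots> \<le> 2 * T + sqrt (2 * (2 * T) * (q * T))"
      using True q by (intro add_mono real_sqrt_le_mono mult_right_mono mult_left_mono) auto
    also have "sqrt (2 * (2 * T) * (q * T)) = sqrt (q * (2 * T)\<^sup>2)" by (simp add: power2_eq_square mult_ac)
    also have "2 * T + sqrt (q * (2 * T)\<^sup>2) = 2 * T * (1 + sqrt q)"
      using T0 by (simp add: real_sqrt_mult algebra_simps)
    also have "\<dots> < B" unfolding B_def using T0 q by (intro mult_strict_right_mono) (auto simp: add_pos_nonneg)
    finally have MB: "M < B" .
    have "real (\<Sum>a\<in>A. card {i \<in> v a. affine_hash p s i < 2 ^ k}) < B" for s
    proof -
      have "(\<Sum>a\<in>A. card {i \<in> v a. affine_hash p s i < 2 ^ k}) \<le> (\<Sum>a\<in>A. card (v a))"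
        using finv by (intro sum_mono card_mono) auto
      then have "real (\<Sum>a\<in>A. card {i \<in> v a. affine_hash p s i < 2 ^ k}) \<le> M"
        unfolding M_def by (simp only: of_nat_le_iff)
      then show ?thesis using MB by linarith
    qed
    then show ?thesis by (intro exI[of _ k]) simp
  next
    case False
    then have F: "F \<ge> 2 * T" by simp
    then have F0: "F > 0" using T0 by linarith
    have Fp: "F \<le> p" using card_mono[OF _ U] by (simp add: F_def)
    define j where "j = (LEAST j. 2 * T * p \<le> 2 ^ j * F)"
    have exk: "2 * T * p \<le> 2 ^ k * F"
    proof -
      have "real p \<le> real (2 ^ k)" using p(2) by (simp only: of_nat_le_iff)
      then have "real (2 * T) * real p \<le> F * real (2 ^ k)"
        using F F0 by (intro mult_mono) auto
      then show ?thesis by (simp add: mult.commute)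
    qed
    then have jk: "j \<le> k" unfolding j_def by (rule Least_le)
    have j_ge: "2 * T * p \<le> 2 ^ j * F" unfolding j_def using exk by (rule LeastI)
    \<comment> \<open>Bounds above \<open>p\<close> select everything; capping at \<open>p\<close>
      meets the hypothesis of the counting lemmas.\<close>
    define x where "x = min (2 ^ j) p"
    have xp: "x \<le> p" by (simp add: x_def)
    have hx: "affine_hash p s i < 2 ^ j \<longleftrightarrow> affine_hash p s i < x" for s i
      using affine_hash_less[OF p0, of s i] by (auto simp: x_def)
    define \<mu> where "\<mu> = F * x / p"
    have \<mu>_ge: "2 * T \<le> \<mu>"
    proof (cases "2 ^ j \<le> p")
      case True
      then show ?thesis using j_ge p0 by (simp add: \<mu>_def x_def le_divide_eq mult_ac)
    next
      case False
      then show ?thesis using F p0 by (simp add: \<mu>_def x_def)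
    qed
    have \<mu>_le: "\<mu> \<le> 4 * T"
    proof -
      have "2 ^ j * F \<le> 4 * T * p"
      proof (cases j)
        case 0
        have "F \<le> 1 * real p" using Fp by simp
        also have "\<dots> \<le> 4 * real T * real p" using T by (intro mult_right_mono) auto
        finally show ?thesis using 0 by simp
      next
        case (Suc j')
        then have "\<not> 2 * T * p \<le> 2 ^ j' * F" unfolding j_def by (intro not_less_Least) simp
        moreover have "2 ^ j * F = 2 * (2 ^ j' * F)" by (simp add: Suc)
        ultimately have "2 ^ j * F \<le> 2 * real (2 * T * p)" by linarith
        then show ?thesis by simp
      qed
      moreover have "F * x \<le> F * 2 ^ j" using F0 by (simp add: x_def)
      ultimately have "F * x \<le> 4 * T * p" by (simp add: mult.commute)
      then show ?thesis using p0 by (simp add: \<mu>_def divide_le_eq)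
    qed
    let ?B1 = "{s \<in> {..<p * p}. \<bar>real (card {i \<in> U. affine_hash p s i < x}) - real (card U) * x / p\<bar> \<ge> \<mu> / 2}"
    let ?B2 = "{s \<in> {..<p * p}. real (\<Sum>a\<in>A. card {i \<in> v a. affine_hash p s i < x}) \<ge> B}"
    let ?Bad = "{s \<in> {..<p * p}.
      \<not> ((j = k \<or> T \<le> card {i \<in> U. affine_hash p s i < 2 ^ j}) \<and>
         real (\<Sum>a\<in>A. card {i \<in> v a. affine_hash p s i < 2 ^ j}) < B)}"
    have "?Bad \<subseteq> ?B1 \<union> ?B2"
    proof
      fix s assume s: "s \<in> ?Bad"
      show "s \<in> ?B1 \<union> ?B2"
      proof (cases "T \<le> card {i \<in> U. affine_hash p s i < x}")
        case True
        then show ?thesis using s by (auto simp: hx)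
      next
        case False
        then have "real (card {i \<in> U. affine_hash p s i < x}) < T" by simp
        then have "\<bar>real (card {i \<in> U. affine_hash p s i < x}) - \<mu>\<bar> \<ge> \<mu> / 2" using \<mu>_ge by linarith
        then show ?thesis using s by (simp add: \<mu>_def F_def)
      qed
    qed
    then have "card ?Bad \<le> card (?B1 \<union> ?B2)" by (intro card_mono) auto
    also have "\<dots> \<le> card ?B1 + card ?B2" by (rule card_Un_le)
    finally have "real (card ?Bad) \<le> real (card ?B1) + real (card ?B2)" by linarith
    also have "\<dots> \<le> real (p * p) * (2 / T) + real (p * p) * (1 / 24)"
    proof (rule add_mono)
      have half: "\<mu> / 2 > 0" using \<mu>_ge T0 by linarith
      have "real (card ?B1) \<le> real (p * p) * (real (card U) * x / p / (\<mu> / 2)\<^sup>2)"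
        by (rule card_sample_deviation_le[OF p(1) U xp half])
      also have "\<dots> \<le> real (p * p) * (2 / T)"
      proof (rule mult_left_mono)
        have "real (card U) * x / p / (\<mu> / 2)\<^sup>2 = \<mu> / (\<mu> / 2)\<^sup>2" by (simp add: \<mu>_def F_def)
        also have "\<dots> = 4 / \<mu>" using half by (simp add: power2_eq_square)
        also have "\<dots> \<le> 4 / (2 * T)" using \<mu>_ge T0 by (intro divide_left_mono) auto
        finally show "real (card U) * x / p / (\<mu> / 2)\<^sup>2 \<le> 2 / T" by simp
      qed simp
      finally show "real (card ?B1) \<le> real (p * p) * (2 / T)" .
      have "real (card ?B2) \<le> real (p * p) * (real (\<Sum>a\<in>A. card (v a)) * x / p / B)"
        by (rule card_sample_load_ge[OF p(1) v xp B0])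
      also have "real (\<Sum>a\<in>A. card (v a)) * x / p / B \<le> 1 / 24"
      proof -
        have "M \<le> F + sqrt (2 * F * (q * T))" using load by (simp add: M_def F_def)
        \<comment> \<open>Here \<open>2 * T <= F\<close> turns the load into a multiple of
          \<open>F\<close>, which the sampling rate scales down to a multiple of
          \<open>T\<close>.\<close>
        also have "\<dots> \<le> F + sqrt (F * (q * F))"
        proof -
          have "F * q * (2 * T) \<le> F * q * F" using F F0 q by (intro mult_left_mono) auto
          then show ?thesis by (simp add: mult_ac)
        qed
        also have "sqrt (F * (q * F)) = F * sqrt q"
          using F0 by (simp add: real_sqrt_mult)
        finally have "M \<le> F * (1 + sqrt q)" by (simp add: distrib_left)
        then have "M * (x / p) \<le> F * (1 + sqrt q) * (x / p)" by (intro mult_right_mono) auto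
        also have "\<dots> = \<mu> * (1 + sqrt q)" by (simp add: \<mu>_def)
        also have "\<dots> \<le> 4 * T * (1 + sqrt q)" using \<mu>_le q by (intro mult_right_mono) auto
        also have "\<dots> = B * (1 / 24)" by (simp add: B_def)
        finally have "M * x / p \<le> 1 / 24 * B" by (simp add: mult.commute)
        then show ?thesis unfolding M_def pos_divide_le_eq[OF B0] .
      qed
      finally show "real (card ?B2) \<le> real (p * p) * (1 / 24)" by (simp add: mult_left_mono)
    qed
    also have "\<dots> = real (p * p) * (2 / T + 1 / 24)" by (rule distrib_left[symmetric])
    finally show ?thesis using jk by blast
  qed
qed

text \<open>Success and cost will depend on the coordinator's seed alone, so probabilities reduce to
  counting seeds.\<close>

lemma prob_component_uniform:
  assumes "\<alpha> \<ge> 1" "N > 0" "G \<subseteq> {..<N}"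
    and coins: "prot_coins P 0 = pmf_of_set {..<N}"
  shows "measure_pmf.prob (coin_dist P \<alpha>) {r. r 0 \<in> G} = card G / N"
    and "r \<in> set_pmf (coin_dist P \<alpha>) \<Longrightarrow> r 0 < N"
proof -
  have map: "map_pmf (\<lambda>r. r 0) (coin_dist P \<alpha>) = pmf_of_set {..<N}"
    using assms(1) coins by (simp add: coin_dist_def Pi_pmf_component)
  have ne: "{..<N} \<noteq> {}" using assms(2) by auto
  have "measure_pmf.prob (coin_dist P \<alpha>) {r. r 0 \<in> G}
      = measure_pmf.prob (map_pmf (\<lambda>r. r 0) (coin_dist P \<alpha>)) G"
    by (simp add: vimage_def)
  also have "\<dots> = card G / N"
    unfolding map using ne assms(3) by (simp add: measure_pmf_of_set Int_absorb1)
  finally show "measure_pmf.prob (coin_dist P \<alpha>) {r. r 0 \<in> G} = card G / N" .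
  assume "r \<in> set_pmf (coin_dist P \<alpha>)"
  then have "r 0 \<in> set_pmf (map_pmf (\<lambda>r. r 0) (coin_dist P \<alpha>))" by simp
  then show "r 0 < N" unfolding map using ne by simp
qed

section \<open>Choice of the modulus and the sample size\<close>

lemma exists_hash_modulus:
  fixes n :: nat
  assumes "n \<ge> 1"
  obtains p k where "prime p" "n < p" "p \<le> 2 ^ k" "1 \<le> k" "real k \<le> 6 * log 2 (real n + 1)"
proof -
  obtain p where p: "prime p" "n < p" "p \<le> 8 * n\<^sup>2 + 1"
    using exists_prime_between[OF assms] by blast
  have p2: "p \<ge> 2" using p(1) by (rule prime_ge_2_nat)
  define k where "k = (LEAST k. p \<le> 2 ^ k)"
  have "p \<le> 2 ^ p" using less_exp[of p] by simp
  then have pk: "p \<le> 2 ^ k" unfolding k_def by (rule LeastI)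
  have k1: "1 \<le> k" using pk p2 by (cases k) auto
  \<comment> \<open>By minimality \<open>2^(k - 1) < p <= 8 * (n + 1)^2\<close>, so
    \<open>k <= 4 + 2 * log 2 (n + 1)\<close>; the logarithm is at least 1 and absorbs the
    4.\<close>
  have "\<not> p \<le> 2 ^ (k - 1)" unfolding k_def by (rule not_less_Least) (use k1 in \<open>simp add: k_def\<close>)
  then have "2 ^ (k - 1) < 8 * n\<^sup>2 + 1" using p(3) by linarith
  also have "\<dots> \<le> 8 * (n + 1)\<^sup>2" by (simp add: power2_eq_square)
  finally have "real (2 ^ (k - 1)) \<le> real (8 * (n + 1)\<^sup>2)" by (simp only: of_nat_le_iff)
  then have "log 2 (real (2 ^ (k - 1))) \<le> log 2 (real (8 * (n + 1)\<^sup>2))" by (intro log_mono) auto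
  then have "real (k - 1) \<le> log 2 (8 * (real n + 1)\<^sup>2)" by (simp add: add.commute log_nat_power)
  also have "\<dots> = log 2 8 + 2 * log 2 (real n + 1)"
    by (simp add: log_mult log_nat_power add_nonneg_pos)
  also have "log 2 8 = (3::real)"
    using log_pow_cancel[of "2::real" 3] by simp
  finally have "real k \<le> 4 + 2 * log 2 (real n + 1)" using k1 by simp
  moreover have "1 \<le> log 2 (real n + 1)" using assms by simp
  ultimately have "real k \<le> 6 * log 2 (real n + 1)" by linarith
  then show ?thesis using that p pk k1 by blast
qed

text \<open>The value 96 makes both \<open>6 / (T * \<epsilon>^2)\<close> and
  \<open>2 / T + 1 / 24\<close> at most \<open>1 / 16\<close>. Rounding up adds less than
  \<open>1 / \<epsilon>^2\<close>, whence 97.\<close>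

lemma sample_size:
  fixes \<epsilon> :: real
  assumes "0 < \<epsilon>" "\<epsilon> < 1"
  obtains T :: nat where "1 \<le> T" "2 \<le> T * \<epsilon>" "96 \<le> T * \<epsilon>\<^sup>2" "96 \<le> real T" "T \<le> 97 * (1 / \<epsilon>\<^sup>2)"
proof -
  define T where "T = nat \<lceil>96 / \<epsilon>\<^sup>2\<rceil>"
  have e: "0 < \<epsilon>\<^sup>2" "\<epsilon>\<^sup>2 \<le> 1" "\<epsilon>\<^sup>2 \<le> \<epsilon>"
    using assms by (auto simp: power2_eq_square mult_le_one intro: mult_left_le)
  have rT: "real T = of_int \<lceil>96 / \<epsilon>\<^sup>2\<rceil>" unfolding T_def using e by simp
  have ge: "96 / \<epsilon>\<^sup>2 \<le> real T" unfolding rT by (rule le_of_int_ceiling)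
  then have T96: "96 \<le> T * \<epsilon>\<^sup>2" using e by (simp add: divide_le_eq)
  moreover have "T * \<epsilon>\<^sup>2 \<le> T * \<epsilon>" by (rule mult_left_mono[OF e(3)]) simp
  moreover have "T * \<epsilon>\<^sup>2 \<le> real T * 1" by (rule mult_left_mono[OF e(2)]) simp
  moreover have "real T \<le> 97 * (1 / \<epsilon>\<^sup>2)"
  proof -
    have "1 \<le> 1 / \<epsilon>\<^sup>2" using e by (simp add: le_divide_eq)
    moreover have "real T < 96 / \<epsilon>\<^sup>2 + 1" unfolding rT using ceiling_correct[of "96 / \<epsilon>\<^sup>2"] by linarith
    ultimately show ?thesis by simp
  qed
  ultimately show ?thesis by (intro that[of T]) linarith+
qed

theorem theorem1p1:
  fixes c :: real
  assumes "c > 0"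
  shows "\<exists>K::real. \<forall>(n::nat) (\<alpha>::nat) (\<epsilon>::real) (\<beta>::real).
    n \<ge> 1 \<longrightarrow> \<alpha> \<ge> 1 \<longrightarrow> 0 < \<epsilon> \<longrightarrow> \<epsilon> < 1 \<longrightarrow> \<beta> \<ge> 1 \<longrightarrow>
    (\<exists>P::protocol. \<forall>v::nat \<Rightarrow> nat set.
       (\<forall>a<\<alpha>. v a \<subseteq> {1..n}) \<longrightarrow>
       real (collisions \<alpha> v) \<le> \<beta> * c * min (real (F0 \<alpha> v)) (1 / \<epsilon>^2) \<longrightarrow>
       (\<forall>r \<in> set_pmf (coin_dist P \<alpha>). \<exists>t. halts_with P \<alpha> v r t \<and>
          real (length t) \<le> K * (real \<alpha> * log 2 (real n + 1)
             + min (real (F0 \<alpha> v)) (1 / \<epsilon>^2) * sqrt \<beta> * log 2 (real n + 1)))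
       \<and> measure_pmf.prob (coin_dist P \<alpha>)
           {r. \<exists>t. halts_with P \<alpha> v r t \<and> rel_approx \<epsilon> (real (F0 \<alpha> v)) (prot_outp P (v 0) (r 0) t)}
         \<ge> 2/3)"
proof (rule exI[of _ "111744 * (1 + sqrt c) + 26"], intro allI impI)
  \<comment> \<open>\<open>111744 = 12 * 96 * 97\<close>, where \<open>12\<close> comes from \<open>k + 1 \<le> 12 log (n + 1)\<close>, \<open>96\<close> from the
    load bound \<open>B\<close>, and \<open>97\<close> from \<open>T \<le> 97 / \<epsilon>\<^sup>2\<close>.\<close>
  fix n \<alpha> :: nat and \<epsilon> \<beta> :: real
  assume n: "n \<ge> 1" and \<alpha>: "\<alpha> \<ge> 1" and \<epsilon>: "0 < \<epsilon>" "\<epsilon> < 1" and \<beta>: "\<beta> \<ge> 1"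
  define lg where "lg = log 2 (real n + 1)"
  have lg: "lg \<ge> 1" using n by (simp add: lg_def)
  obtain p k where p: "prime p" "n < p" "p \<le> 2 ^ k" "1 \<le> k" "real k \<le> 6 * lg"
    using exists_hash_modulus[OF n] unfolding lg_def by blast
  obtain T where T: "1 \<le> T" "2 \<le> T * \<epsilon>" "96 \<le> T * \<epsilon>\<^sup>2" "96 \<le> real T" "T \<le> 97 * (1 / \<epsilon>\<^sup>2)"
    using sample_size[OF \<epsilon>] by blast
  have p0: "p > 0" using p(1) by (rule prime_gt_0_nat)
  define q where "q = \<beta> * c"
  have q: "q \<ge> 0" using \<beta> assms by (simp add: q_def)
  define B where "B = 96 * T * (1 + sqrt q)"
  have B0: "B \<ge> 0" using q by (simp add: B_def)
  \<comment> \<open>Per player there are \<open>2 * k\<close> seed bits and at most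
    \<open>k + 1\<close> level markers; each item costs \<open>k + 1\<close> bits. The final
    \<open>+ 1\<close> keeps a good run strictly below the budget.\<close>
  define L where "L = nat \<lceil>(3 * real k + 1) * \<alpha> + (real k + 1) * B\<rceil> + 1"
  define coins where "coins a = (if a = 0 then pmf_of_set {..<p * p} else return_pmf 0)" for a :: nat
  \<comment> \<open>Seeds are below \<open>p * p <= 2^(2 * k)\<close>. With \<open>Suc k\<close>
    levels the last cutoff is \<open>2^k >= p\<close>, so every item has a level.\<close>
  interpret level_protocol \<alpha> "2 * k" k "Suc k" T L "hash_level p" "bottom_estimate p T" coins
    by unfold_locales (rule p(4))
  have lead: "1 + sqrt q \<le> (1 + sqrt c) * sqrt \<beta>"
    using \<beta> assms by (simp add: q_def real_sqrt_mult algebra_simps)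
  show "\<exists>P. \<forall>v. (\<forall>a<\<alpha>. v a \<subseteq> {1..n}) \<longrightarrow>
       real (collisions \<alpha> v) \<le> \<beta> * c * min (real (F0 \<alpha> v)) (1 / \<epsilon>^2) \<longrightarrow>
       (\<forall>r \<in> set_pmf (coin_dist P \<alpha>). \<exists>t. halts_with P \<alpha> v r t \<and>
          real (length t) \<le> (111744 * (1 + sqrt c) + 26) * (real \<alpha> * log 2 (real n + 1)
             + min (real (F0 \<alpha> v)) (1 / \<epsilon>^2) * sqrt \<beta> * log 2 (real n + 1)))
       \<and> measure_pmf.prob (coin_dist P \<alpha>)
           {r. \<exists>t. halts_with P \<alpha> v r t \<and> rel_approx \<epsilon> (real (F0 \<alpha> v)) (prot_outp P (v 0) (r 0) t)}
         \<ge> 2/3"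
  proof (intro exI[of _ prot] allI impI)
    fix v :: "nat \<Rightarrow> nat set"
    assume v: "\<forall>a<\<alpha>. v a \<subseteq> {1..n}"
      and C: "real (collisions \<alpha> v) \<le> \<beta> * c * min (real (F0 \<alpha> v)) (1 / \<epsilon>^2)"
    define F where "F = real (F0 \<alpha> v)"
    \<comment> \<open>The coordinator is left out, as its items are never sent.\<close>
    let ?A = "{1..<\<alpha>}"
    let ?U = "\<Union>a\<in>?A. v a"
    have fin: "finite (v a)" if "a < \<alpha>" for a
      using v that finite_subset[of "v a" "{1..n}"] by blast
    have vp: "v a \<subseteq> {..<p}" if "a < \<alpha>" for a using v that p(2) by force
    have vk: "i < 2 ^ k" if "a < \<alpha>" "i \<in> v a" for a i using vp[OF that(1)] that(2) p(3) by force
    have Up: "(\<Union>a<\<alpha>. v a) \<subseteq> {..<p}" using vp by blast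
    have FU: "card ?U \<le> F0 \<alpha> v" unfolding F0_def by (intro card_mono) (auto simp: fin)
    define M where "M = real (\<Sum>a\<in>?A. card (v a))"
    have M: "M \<le> card ?U + sqrt (2 * real (card ?U) * real (collisions \<alpha> v))"
    proof -
      let ?C = "{(a, b, i). a \<in> ?A \<and> b \<in> ?A \<and> a < b \<and> i \<in> v a \<and> i \<in> v b}"
      have "card ?C \<le> collisions \<alpha> v" unfolding collisions_def
      proof (rule card_mono)
        show "finite {(a, b, i). a < b \<and> b < \<alpha> \<and> i \<in> v a \<and> i \<in> v b}"
          by (rule finite_subset[of _ "{..<\<alpha>} \<times> {..<\<alpha>} \<times> (\<Union>a<\<alpha>. v a)"]) (auto simp: fin)
      qed auto
      then have "sqrt (2 * real (card ?U) * real (card ?C)) \<le> sqrt (2 * real (card ?U) * real (collisions \<alpha> v))"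
        by (intro real_sqrt_le_mono mult_left_mono) auto
      moreover have "M \<le> card ?U + sqrt (2 * real (card ?U) * real (card ?C))"
        unfolding M_def by (rule sum_card_le_union_collisions) (auto simp: fin)
      ultimately show ?thesis by linarith
    qed
    \<comment> \<open>The collision bound is used in two forms: with \<open>T\<close> for the
      sampled load, with \<open>F\<close> for sending all occurrences.\<close>
    have C_T: "collisions \<alpha> v \<le> q * T"
    proof -
      have "1 / \<epsilon>\<^sup>2 \<le> T" using T(3) \<epsilon> by (simp add: divide_le_eq)
      then have "q * min F (1 / \<epsilon>\<^sup>2) \<le> q * T" using q by (intro mult_left_mono) auto
      then show ?thesis using C unfolding q_def F_def by linarith
    qed
    have C_F: "collisions \<alpha> v \<le> q * F"
    proof -
      have "q * min F (1 / \<epsilon>\<^sup>2) \<le> q * F" using q by (intro mult_left_mono) auto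
      then show ?thesis using C unfolding q_def F_def by linarith
    qed
    have load: "M \<le> real (card ?U) + sqrt (2 * real (card ?U) * (q * real T))"
    proof -
      have "2 * real (card ?U) * real (collisions \<alpha> v) \<le> 2 * real (card ?U) * (q * real T)"
        using C_T by (intro mult_left_mono) auto
      then have "sqrt (2 * real (card ?U) * real (collisions \<alpha> v)) \<le> sqrt (2 * real (card ?U) * (q * real T))"
        by (rule real_sqrt_le_mono)
      then show ?thesis using M by linarith
    qed
    have M_F: "M \<le> 2 * F * (1 + sqrt q)"
    proof -
      have "M \<le> F + sqrt (2 * F * (q * F))"
      proof (rule order.trans[OF M], intro add_mono)
        have "2 * real (card ?U) * real (collisions \<alpha> v) \<le> 2 * F * (q * F)"
          using C_F FU q by (intro mult_mono) (auto simp: F_def)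
        then show "sqrt (2 * real (card ?U) * real (collisions \<alpha> v)) \<le> sqrt (2 * F * (q * F))" by simp
        show "real (card ?U) \<le> F" using FU by (simp add: F_def)
      qed
      also have "2 * F * (q * F) \<le> q * (2 * F)\<^sup>2" using q by (simp add: power2_eq_square F_def mult_ac)
      then have "sqrt (2 * F * (q * F)) \<le> sqrt q * (2 * F)"
        by (metis F_def abs_of_nonneg mult_nonneg_nonneg of_nat_0_le_iff real_sqrt_abs real_sqrt_le_mono real_sqrt_mult zero_le_numeral)
      finally show ?thesis by (simp add: F_def algebra_simps)
    qed
    have per: "real (\<Sum>a\<in>?A. 2 * k + (m + (k + 1) * f a)) \<le> (3 * real k + 1) * (real \<alpha> - 1) + (real k + 1) * real (\<Sum>a\<in>?A. f a)"
      if "m \<le> Suc k" for m :: nat and f :: "nat \<Rightarrow> nat"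
    proof -
      have "(\<Sum>a\<in>?A. 2 * k + (m + (k + 1) * f a)) = (2 * k + m) * (\<alpha> - 1) + (k + 1) * (\<Sum>a\<in>?A. f a)"
        by (simp add: sum.distrib sum_distrib_left algebra_simps)
      also have "\<dots> \<le> (3 * k + 1) * (\<alpha> - 1) + (k + 1) * (\<Sum>a\<in>?A. f a)"
        by (rule add_right_mono[OF mult_right_mono]) (use that in simp_all)
      finally have "real (\<Sum>a\<in>?A. 2 * k + (m + (k + 1) * f a)) \<le> real ((3 * k + 1) * (\<alpha> - 1) + (k + 1) * (\<Sum>a\<in>?A. f a))"
        by (simp only: of_nat_le_iff)
      also have "\<dots> = (3 * real k + 1) * (real \<alpha> - 1) + (real k + 1) * real (\<Sum>a\<in>?A. f a)"
        unfolding of_nat_add of_nat_mult of_nat_diff[OF \<alpha>] by simp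
      finally show ?thesis .
    qed
    have seed: "s < 2 ^ (2 * k)" if "s < p * p" for s
    proof -
      have "p * p \<le> 2 ^ k * 2 ^ k" using p(3) by (rule mult_le_mono) (rule p(3))
      also have "\<dots> = 2 ^ (2 * k)" by (simp add: mult_2 power_add)
      finally show ?thesis using that by simp
    qed
    have coins0: "prot_coins prot 0 = pmf_of_set {..<p * p}" by (simp add: coins_def)
    have pp: "p * p > 0" using p0 by simp
    show "(\<forall>r \<in> set_pmf (coin_dist prot \<alpha>). \<exists>t. halts_with prot \<alpha> v r t \<and>
          real (length t) \<le> (111744 * (1 + sqrt c) + 26) * (real \<alpha> * log 2 (real n + 1)
             + min (real (F0 \<alpha> v)) (1 / \<epsilon>^2) * sqrt \<beta> * log 2 (real n + 1)))
       \<and> measure_pmf.prob (coin_dist prot \<alpha>)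
           {r. \<exists>t. halts_with prot \<alpha> v r t \<and> rel_approx \<epsilon> (real (F0 \<alpha> v)) (prot_outp prot (v 0) (r 0) t)}
         \<ge> 2/3"
    proof (intro conjI ballI)
      fix r assume "r \<in> set_pmf (coin_dist prot \<alpha>)"
      then have r: "r 0 < p * p" by (rule prob_component_uniform(2)[OF \<alpha> pp order.refl coins0])
      obtain t where t: "halts_with prot \<alpha> v r t" "length t \<le> L"
        "length t \<le> (\<Sum>a\<in>?A. 2 * k + (Suc k + (k + 1) * card (v a)))"
        using prot_halts[of r v] seed[OF r] fin vk by blast
      define Q where "Q = min F (1 / \<epsilon>\<^sup>2)"
      have "real (length t) \<le> 26 * lg * \<alpha> + 111744 * (1 + sqrt c) * (Q * sqrt \<beta> * lg)"
      \<comment> \<open>For small \<open>F\<close> the cost of sending everything is within the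
        bound; otherwise the budget \<open>L\<close> is.\<close>
      proof (cases "F \<le> 1 / \<epsilon>\<^sup>2")
        case True
        have "real (length t) \<le> real (\<Sum>a\<in>?A. 2 * k + (Suc k + (k + 1) * card (v a)))"
          using t(3) by (simp only: of_nat_le_iff)
        also have "\<dots> \<le> (3 * real k + 1) * (real \<alpha> - 1) + (real k + 1) * M"
          unfolding M_def by (rule per) simp
        also have "\<dots> \<le> (24 * lg) * \<alpha> + (12 * lg) * (2 * F * ((1 + sqrt c) * sqrt \<beta>))"
        proof (intro add_mono mult_mono)
          have "2 * F * (1 + sqrt q) \<le> 2 * F * ((1 + sqrt c) * sqrt \<beta>)"
            using lead by (intro mult_left_mono) (auto simp: F_def)
          then show "M \<le> 2 * F * ((1 + sqrt c) * sqrt \<beta>)" using M_F by linarith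
        qed (use p(4,5) lg \<alpha> in \<open>auto simp: M_def sum_nonneg\<close>)
        also have "\<dots> = (24 * lg) * \<alpha> + 24 * ((1 + sqrt c) * (F * sqrt \<beta> * lg))" by simp
        also have "\<dots> \<le> 26 * lg * \<alpha> + 111744 * ((1 + sqrt c) * (F * sqrt \<beta> * lg))"
          using lg \<beta> assms by (intro add_mono mult_right_mono) (auto simp: F_def)
        finally have "real (length t) \<le> 26 * lg * \<alpha> + 111744 * ((1 + sqrt c) * (F * sqrt \<beta> * lg))" .
        moreover have "Q = F" using True by (simp add: Q_def)
        ultimately show ?thesis by (simp only: mult.assoc)
      next
        case False
        have "real L \<le> (3 * real k + 1) * \<alpha> + (real k + 1) * B + 2"
        proof -
          have "0 \<le> (3 * real k + 1) * \<alpha> + (real k + 1) * B" using B0 by simp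
          then show ?thesis unfolding L_def by linarith
        qed
        \<comment> \<open>\<open>3 * k + 1 <= 24 * lg\<close>, and the at most 2 bits from the
          rounding and the \<open>+ 1\<close> in \<open>L\<close> fit into
          \<open>2 * lg * \<alpha>\<close>: together the 26 of the constant.\<close>
        also have "\<dots> \<le> (24 * lg) * \<alpha> + (12 * lg) * (96 * (97 * (1 / \<epsilon>\<^sup>2)) * ((1 + sqrt c) * sqrt \<beta>)) + 2 * lg * \<alpha>"
        proof (intro add_mono mult_mono)
          show "B \<le> 96 * (97 * (1 / \<epsilon>\<^sup>2)) * ((1 + sqrt c) * sqrt \<beta>)"
            unfolding B_def using T(5) lead q \<epsilon> by (intro mult_mono) auto
          have "1 * 1 \<le> lg * \<alpha>" using lg \<alpha> by (intro mult_mono) auto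
          then show "2 \<le> 2 * lg * \<alpha>" by simp
        qed (use p(4,5) lg B0 in auto)
        also have "\<dots> = 26 * lg * \<alpha> + 111744 * ((1 + sqrt c) * (1 / \<epsilon>\<^sup>2 * sqrt \<beta> * lg))" by simp
        finally have "real (length t) \<le> 26 * lg * \<alpha> + 111744 * ((1 + sqrt c) * (1 / \<epsilon>\<^sup>2 * sqrt \<beta> * lg))"
          using t(2) by linarith
        moreover have "Q = 1 / \<epsilon>\<^sup>2" using False by (simp add: Q_def)
        ultimately show ?thesis by (simp only: mult.assoc)
      qed
      also have "\<dots> \<le> (111744 * (1 + sqrt c) + 26) * (lg * \<alpha>) + (111744 * (1 + sqrt c) + 26) * (Q * sqrt \<beta> * lg)"
      proof -
        have "0 \<le> Q * sqrt \<beta> * lg" using lg \<beta> \<epsilon> by (simp add: Q_def F_def)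
        then show ?thesis using lg assms unfolding mult.assoc[of 26]
          by (intro add_mono mult_right_mono) auto
      qed
      also have "\<dots> = (111744 * (1 + sqrt c) + 26) * (\<alpha> * lg + Q * sqrt \<beta> * lg)"
        unfolding distrib_left[symmetric] by (simp only: mult.commute)
      finally show "\<exists>t. halts_with prot \<alpha> v r t \<and>
          real (length t) \<le> (111744 * (1 + sqrt c) + 26) * (real \<alpha> * log 2 (real n + 1)
             + min (real (F0 \<alpha> v)) (1 / \<epsilon>^2) * sqrt \<beta> * log 2 (real n + 1))"
        using t(1) unfolding lg_def Q_def F_def by blast
    next
      \<comment> \<open>The level \<open>j\<close> depends on the input and belongs to the analysis
        only; the protocol never computes it.\<close>
      obtain j where j: "j \<le> k" and bad: "real (card {s \<in> {..<p * p}.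
          \<not> ((j = k \<or> T \<le> card {i \<in> ?U. affine_hash p s i < 2 ^ j}) \<and>
            real (\<Sum>a\<in>?A. card {i \<in> v a. affine_hash p s i < 2 ^ j}) < B)})
          \<le> real (p * p) * (2 / T + 1 / 24)"
        using exists_cheap_level[OF p(1,3) _ _ T(1) q, of ?A v] vp load unfolding B_def M_def by auto
      let ?G1 = "\<lambda>s. (j = k \<or> T \<le> card {i \<in> ?U. affine_hash p s i < 2 ^ j}) \<and>
            real (\<Sum>a\<in>?A. card {i \<in> v a. affine_hash p s i < 2 ^ j}) < B"
      let ?G2 = "\<lambda>s. rel_approx \<epsilon> (F0 \<alpha> v) (bottom_estimate p T s (\<Union>a<\<alpha>. v a))"
      let ?G = "{s \<in> {..<p * p}. ?G1 s \<and> ?G2 s}"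
      have "{..<p * p} \<subseteq> ?G \<union> ({s \<in> {..<p * p}. \<not> ?G1 s} \<union> {s \<in> {..<p * p}. \<not> ?G2 s})" by blast
      then have "card {..<p * p} \<le> card (?G \<union> ({s \<in> {..<p * p}. \<not> ?G1 s} \<union> {s \<in> {..<p * p}. \<not> ?G2 s}))"
        by (intro card_mono) auto
      also have "\<dots> \<le> card ?G + (card {s \<in> {..<p * p}. \<not> ?G1 s} + card {s \<in> {..<p * p}. \<not> ?G2 s})"
        by (rule order.trans[OF card_Un_le add_left_mono[OF card_Un_le]])
      finally have all: "real (p * p) \<le> real (card ?G) + (real (card {s \<in> {..<p * p}. \<not> ?G1 s}) + real (card {s \<in> {..<p * p}. \<not> ?G2 s}))"
        by (simp only: card_lessThan of_nat_add[symmetric] of_nat_le_iff)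
      have bad1: "real (card {s \<in> {..<p * p}. \<not> ?G1 s}) \<le> real (p * p) * (1 / 16)"
      proof (rule order.trans[OF bad], rule mult_left_mono)
        have "2 / real T \<le> 1 / 48" using T(4) by (simp add: divide_le_eq)
        then show "2 / real T + 1 / 24 \<le> 1 / 16" by simp
      qed simp
      have "real (card {s \<in> {..<p * p}. \<not> ?G2 s}) \<le> real (p * p) * (6 / (T * \<epsilon>\<^sup>2))"
        unfolding F0_def by (rule card_bad_estimate_le[OF p(1) Up \<epsilon> T(2)])
      also have "\<dots> \<le> real (p * p) * (1 / 16)"
        using T(3) by (intro mult_left_mono) (auto simp: divide_le_eq)
      finally have bad2: "real (card {s \<in> {..<p * p}. \<not> ?G2 s}) \<le> real (p * p) * (1 / 16)" .
      \<comment> \<open>Two failure events of probability at most \<open>1 / 16\<close> each leave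
        at least \<open>7 / 8\<close>.\<close>
      have "N * (2 / 3) \<le> g"
        if "N \<le> g + (b + b')" "b \<le> N * (1 / 16)" "b' \<le> N * (1 / 16)" "0 \<le> N" for N g b b' :: real
        using that by linarith
      from this[OF all bad1 bad2 of_nat_0_le_iff]
      have "real (p * p) * (2 / 3) \<le> real (card ?G)" .
      then have "2 / 3 \<le> card ?G / (p * p)" using pp by (simp add: le_divide_eq mult_ac)
      also have "\<dots> = measure_pmf.prob (coin_dist prot \<alpha>) {r. r 0 \<in> ?G}"
        by (rule prob_component_uniform(1)[OF \<alpha> pp _ coins0, symmetric]) auto
      also have "\<dots> \<le> measure_pmf.prob (coin_dist prot \<alpha>)
           {r. \<exists>t. halts_with prot \<alpha> v r t \<and> rel_approx \<epsilon> (F0 \<alpha> v) (prot_outp prot (v 0) (r 0) t)}"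
      proof (rule measure_pmf.finite_measure_mono)
        show "{r. r 0 \<in> ?G} \<subseteq>
          {r. \<exists>t. halts_with prot \<alpha> v r t \<and> rel_approx \<epsilon> (F0 \<alpha> v) (prot_outp prot (v 0) (r 0) t)}"
        proof
          fix r :: "nat \<Rightarrow> nat" assume "r \<in> {r. r 0 \<in> ?G}"
          then have r: "r 0 < p * p" and G1: "?G1 (r 0)" and G2: "?G2 (r 0)" by auto
          have lv: "card {i \<in> X. hash_level p (r 0) i < Suc j} = card {i \<in> X. affine_hash p (r 0) i < 2 ^ j}" for X
            by (simp only: hash_level_less_Suc)
          obtain t where t: "halts_with prot \<alpha> v r t"
            using prot_halts[of r v] seed[OF r] fin vk by blast
          have "real (\<Sum>a\<in>?A. 2 * k + (Suc j + (k + 1) * card {i \<in> v a. hash_level p (r 0) i < Suc j}))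
              \<le> (3 * real k + 1) * (real \<alpha> - 1) + (real k + 1) * real (\<Sum>a\<in>?A. card {i \<in> v a. hash_level p (r 0) i < Suc j})"
            by (rule per) (use j in simp)
          also have "\<dots> \<le> (3 * real k + 1) * real \<alpha> + (real k + 1) * B"
            unfolding lv using G1 by (intro add_mono mult_left_mono) auto
          also have "\<dots> < real L" unfolding L_def by linarith
          finally have cheap: "(\<Sum>a\<in>?A. 2 * k + (Suc j + (k + 1) * card {i \<in> v a. hash_level p (r 0) i < Suc j})) < L"
            by (simp only: of_nat_less_iff)
          have lev: "Suc j = Suc k \<or> T \<le> card {i \<in> ?U. hash_level p (r 0) i < Suc j}"
            using G1 unfolding lv by auto
          obtain S m where S: "outp (v 0) (r 0) t = bottom_estimate p T (r 0) S" "S \<subseteq> (\<Union>a<\<alpha>. v a)"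
            "{i \<in> (\<Union>a<\<alpha>. v a). hash_level p (r 0) i < m} \<subseteq> S"
            "m = Suc k \<or> T \<le> card {i \<in> (\<Union>a<\<alpha>. v a). hash_level p (r 0) i < m}"
          proof (rule prot_output[where r = r and v = v and t = t and m = "Suc j"])
            show "r 0 < 2 ^ (2 * k)" by (rule seed[OF r])
            show "Suc j \<le> Suc k" using j by simp
          qed (rule t \<alpha> lev cheap | blast intro: fin vk)+
          have "bottom_estimate p T (r 0) S = bottom_estimate p T (r 0) (\<Union>a<\<alpha>. v a)"
            by (rule bottom_estimate_cong[OF _ S(2) p0 p(3) T(1) S(3,4)]) (auto simp: fin)
          then have "rel_approx \<epsilon> (F0 \<alpha> v) (prot_outp prot (v 0) (r 0) t)"
            using G2 S(1) by simp
          then show "r \<in> {r. \<exists>t. halts_with prot \<alpha> v r t \<and> rel_approx \<epsilon> (F0 \<alpha> v) (prot_outp prot (v 0) (r 0) t)}"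
            using t by blast
        qed
      qed simp
      finally show "2 / 3 \<le> measure_pmf.prob (coin_dist prot \<alpha>)
           {r. \<exists>t. halts_with prot \<alpha> v r t \<and> rel_approx \<epsilon> (F0 \<alpha> v) (prot_outp prot (v 0) (r 0) t)}" .
    qed
  qed
qed

end
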